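(* Let $n\ge 2$ be an integer and let $p>1$. There exists a constant $B_{p,n}>0$ depending only on $p$ and $n$ such that for every bounded domain $\Omega\subset\mathbb R^n$ with smooth boundary and every integer $k\ge 1$, $$ \mu_{k,p}\le B_{p,n}\left(\frac{k}{|\Omega|}\right)^{\frac{p}{n}}, $$ where $\mu_{k,p}$ denotes the $k$-th variational eigenvalue of the Neumann $p$-Laplacian on $\Omega$ and $|\Omega|$ denotes the Lebesgue measure of $\Omega$.
   Context: A bounded domain is a bounded connected open set. Variational eigenvalues. $W^{1,p}(\Omega)$ is the usual Sobolev space of real functions with norm $\|u\|_{W^{1,p}(\Omega)}^p=\int_\Omega(|\nabla u|^p+|u|^p)\,dx$. The variational eigenvalues of the Neumann $p$-Laplacian (problem $-{\rm div}(|\nabla u|^{p-2}\nabla u)=\mu|u|^{p-2}u$ in $\Omega$, $\partial u/\partial\nu=0$ on $\partial\Omega$) are $$\mu_{k,p}:=\inf_{F\in\Gamma_k}\sup_{u\in F}\frac{\int_\Omega|\nabla u|^p\,dx}{\int_\Omega|u|^p\,dx},\qquad k=1,2,\dots,$$ where $\Gamma_k$ is the family of sets $F\subset W^{1,p}(\Omega)\setminus\{0\}$ such that $F\cap\{u:\|u\|_{L^p(\Omega)}=1\}$ is compact, $F$ is symmetric ($F=-F$), and $\gamma(F)\ge k$. Here $\gamma(F)$ is the Krasnoselskii genus: the minimum $\ell\in\mathbb N$ for which there exists a continuous odd map $f:F\to\mathbb R^\ell\setminus\{0\}$ (and $+\infty$ if there is no such $\ell$). With this numbering $\mu_{1,p}=0$.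 *)

theory Defs
  imports "HOL-Analysis.Analysis" "HOL-Library.Extended_Nat"
begin

subsection \<open>Smooth functions and domains\<close>

text \<open>\<open>C\<^sup>m\<close> and \<open>C\<^sup>\<infinity>\<close> regularity, meant for open \<open>S\<close>: the derivatives are taken at \<open>x\<close>, not within \<open>S\<close>.\<close>

primrec times_cont_differentiable_on ::
    "nat \<Rightarrow> 'a::real_normed_vector set \<Rightarrow> ('a \<Rightarrow> 'b::real_normed_vector) \<Rightarrow> bool" where
  "times_cont_differentiable_on 0 S f \<longleftrightarrow> continuous_on S f"
| "times_cont_differentiable_on (Suc m) S f \<longleftrightarrow>
     (\<forall>x\<in>S. f differentiable (at x)) \<and>
     (\<forall>v. times_cont_differentiable_on m S (\<lambda>x. frechet_derivative f (at x) v))"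

definition smooth_on :: "'a::real_normed_vector set \<Rightarrow> ('a \<Rightarrow> 'b::real_normed_vector) \<Rightarrow> bool" where
  "smooth_on S f \<longleftrightarrow> (\<forall>m. times_cont_differentiable_on m S f)"

text \<open>Elements of \<open>C\<^sub>c\<^sup>\<infinity>(\<Omega>)\<close>, extended by zero to the whole space.\<close>

definition test_function :: "'a::euclidean_space set \<Rightarrow> ('a \<Rightarrow> real) \<Rightarrow> bool" where
  "test_function \<Omega> \<phi> \<longleftrightarrow>
     smooth_on UNIV \<phi> \<and> compact (closure {x. \<phi> x \<noteq> 0}) \<and> closure {x. \<phi> x \<noteq> 0} \<subseteq> \<Omega>"

definition bounded_domain :: "'a::euclidean_space set \<Rightarrow> bool" where
  "bounded_domain \<Omega> \<longleftrightarrow> open \<Omega> \<and> connected \<Omega> \<and> bounded \<Omega> \<and> \<Omega> \<noteq> {}"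

text \<open>Near each boundary point, \<open>\<Omega>\<close> is the strict epigraph of a smooth function in suitable
  orthonormal coordinates. The unit vector \<open>e\<close> is the last coordinate direction; the remaining
  \<open>n - 1\<close> coordinates of \<open>x\<close> are represented by the projection \<open>x - (x \<bullet> e) e\<close> onto the
  hyperplane orthogonal to \<open>e\<close>, so only the restriction of \<open>h\<close> to this hyperplane matters.\<close>

definition smooth_boundary :: "'a::euclidean_space set \<Rightarrow> bool" where
  "smooth_boundary \<Omega> \<longleftrightarrow>
     (\<forall>x0\<in>frontier \<Omega>. \<exists>r>0. \<exists>e (h :: 'a \<Rightarrow> real). norm e = 1 \<and> smooth_on UNIV h \<and>
        \<Omega> \<inter> ball x0 r = {x \<in> ball x0 r. x \<bullet> e > h (x - (x \<bullet> e) *\<^sub>R e)})"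

subsection \<open>The Sobolev space\<close>

text \<open>\<open>g\<close> is a weak gradient of \<open>u\<close> on \<open>\<Omega>\<close>; both are locally integrable on \<open>\<Omega>\<close>.\<close>

definition has_weak_gradient :: "'a::euclidean_space set \<Rightarrow> ('a \<Rightarrow> real) \<Rightarrow> ('a \<Rightarrow> 'a) \<Rightarrow> bool" where
  "has_weak_gradient \<Omega> u g \<longleftrightarrow>
     (\<forall>K. compact K \<and> K \<subseteq> \<Omega> \<longrightarrow> integrable (lebesgue_on K) u \<and> integrable (lebesgue_on K) g) \<and>
     (\<forall>\<phi>. test_function \<Omega> \<phi> \<longrightarrow>
        (\<forall>b\<in>Basis. (LINT x|lebesgue_on \<Omega>. u x * frechet_derivative \<phi> (at x) b) =
                   - (LINT x|lebesgue_on \<Omega>. (g x \<bullet> b) * \<phi> x)))"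

text \<open>The weak gradient is unique up to null sets, so the choice is immaterial under integrals.\<close>

definition weak_gradient :: "'a::euclidean_space set \<Rightarrow> ('a \<Rightarrow> real) \<Rightarrow> 'a \<Rightarrow> 'a" where
  "weak_gradient \<Omega> u = (SOME g. has_weak_gradient \<Omega> u g)"

text \<open>The elements of \<open>W\<^sup>1\<^sup>,\<^sup>p(\<Omega>)\<close> are represented by functions instead of classes of functions
  modulo equality almost everywhere on \<open>\<Omega>\<close> (values outside \<open>\<Omega>\<close> play no role). Accordingly
  \<open>sobolev_norm\<close> is a seminorm, and the associated topology identifies precisely
  the functions that agree almost everywhere on \<open>\<Omega>\<close>: compactness of a set of
  representatives is compactness of its image in the quotient, and a continuous
  map into a Hausdorff space factors through the quotient.\<close>

definition sobolev_space :: "real \<Rightarrow> 'a::euclidean_space set \<Rightarrow> ('a \<Rightarrow> real) set" where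
  "sobolev_space p \<Omega> =
     {u. u \<in> borel_measurable (lebesgue_on \<Omega>) \<and>
         integrable (lebesgue_on \<Omega>) (\<lambda>x. \<bar>u x\<bar> powr p) \<and>
         (\<exists>g. has_weak_gradient \<Omega> u g \<and> g \<in> borel_measurable (lebesgue_on \<Omega>) \<and>
              integrable (lebesgue_on \<Omega>) (\<lambda>x. norm (g x) powr p))}"

definition lp_norm :: "real \<Rightarrow> 'a::euclidean_space set \<Rightarrow> ('a \<Rightarrow> real) \<Rightarrow> real" where
  "lp_norm p \<Omega> u = (LINT x|lebesgue_on \<Omega>. \<bar>u x\<bar> powr p) powr (1 / p)"

definition sobolev_norm :: "real \<Rightarrow> 'a::euclidean_space set \<Rightarrow> ('a \<Rightarrow> real) \<Rightarrow> real" where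
  "sobolev_norm p \<Omega> u =
     (LINT x|lebesgue_on \<Omega>. norm (weak_gradient \<Omega> u x) powr p + \<bar>u x\<bar> powr p) powr (1 / p)"

definition sobolev_topology :: "real \<Rightarrow> 'a::euclidean_space set \<Rightarrow> ('a \<Rightarrow> real) topology" where
  "sobolev_topology p \<Omega> =
     topology (\<lambda>U. U \<subseteq> sobolev_space p \<Omega> \<and>
       (\<forall>u\<in>U. \<exists>\<epsilon>>0. \<forall>v\<in>sobolev_space p \<Omega>. sobolev_norm p \<Omega> (v - u) < \<epsilon> \<longrightarrow> v \<in> U))"

lemma openin_sobolev_topology:
  "openin (sobolev_topology p \<Omega>) U \<longleftrightarrow> U \<subseteq> sobolev_space p \<Omega> \<and>
     (\<forall>u\<in>U. \<exists>\<epsilon>>0. \<forall>v\<in>sobolev_space p \<Omega>. sobolev_norm p \<Omega> (v - u) < \<epsilon> \<longrightarrow> v \<in> U)"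
proof -
  let ?W = "sobolev_space p \<Omega>" and ?N = "sobolev_norm p \<Omega>"
  let ?O = "\<lambda>U. U \<subseteq> ?W \<and> (\<forall>u\<in>U. \<exists>\<epsilon>>0. \<forall>v\<in>?W. ?N (v - u) < \<epsilon> \<longrightarrow> v \<in> U)"
  have "?O (S \<inter> T)" if S: "?O S" and T: "?O T" for S T
  proof (intro conjI ballI)
    show "S \<inter> T \<subseteq> ?W" using S by blast
  next
    fix u assume u: "u \<in> S \<inter> T"
    obtain a where a: "a > 0" "\<forall>v\<in>?W. ?N (v - u) < a \<longrightarrow> v \<in> S" using S u by blast
    obtain b where b: "b > 0" "\<forall>v\<in>?W. ?N (v - u) < b \<longrightarrow> v \<in> T" using T u by blast
    show "\<exists>\<epsilon>>0. \<forall>v\<in>?W. ?N (v - u) < \<epsilon> \<longrightarrow> v \<in> S \<inter> T"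
      by (rule exI[of _ "min a b"]) (use a b in auto)
  qed
  moreover have "?O (\<Union>K)" if K: "\<forall>S\<in>K. ?O S" for K
  proof (intro conjI ballI)
    show "\<Union>K \<subseteq> ?W" using K by blast
  next
    fix u assume "u \<in> \<Union>K"
    then obtain S where S: "S \<in> K" "u \<in> S" by blast
    then obtain a where "a > 0" "\<forall>v\<in>?W. ?N (v - u) < a \<longrightarrow> v \<in> S" using K by blast
    then show "\<exists>\<epsilon>>0. \<forall>v\<in>?W. ?N (v - u) < \<epsilon> \<longrightarrow> v \<in> \<Union>K" using S by blast
  qed
  ultimately have "istopology ?O" unfolding istopology_def by blast
  then show ?thesis by (simp add: sobolev_topology_def topology_inverse')
qed

lemma topspace_sobolev_topology [simp]:
  "topspace (sobolev_topology p \<Omega>) = sobolev_space p \<Omega>"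
proof
  show "topspace (sobolev_topology p \<Omega>) \<subseteq> sobolev_space p \<Omega>"
    using openin_topspace openin_sobolev_topology by blast
  have "openin (sobolev_topology p \<Omega>) (sobolev_space p \<Omega>)"
    unfolding openin_sobolev_topology using zero_less_one by blast
  then show "sobolev_space p \<Omega> \<subseteq> topspace (sobolev_topology p \<Omega>)"
    by (rule openin_subset)
qed

subsection \<open>Variational eigenvalues\<close>

text \<open>Krasnoselskii genus of a symmetric set \<open>F\<close> with respect to the topology \<open>X\<close>. Here
  \<open>Euclidean_space l\<close> is \<open>\<real>\<^sup>l\<close>, realised as the sequences vanishing from index \<open>l\<close> on, and
  \<open>- u\<close> and \<open>- f u\<close> are pointwise negations. The infimum of the empty set
  in \<^typ>\<open>enat\<close> is \<open>\<infinity>\<close>; the empty set \<open>F\<close> has genus \<open>0\<close>.\<close>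

definition genus :: "('a \<Rightarrow> real) topology \<Rightarrow> ('a \<Rightarrow> real) set \<Rightarrow> enat" where
  "genus X F = Inf {enat l | l.
     \<exists>f. continuous_map (subtopology X F) (subtopology (Euclidean_space l) (- {\<lambda>i. 0})) f \<and>
         (\<forall>u\<in>F. f (- u) = - f u)}"

definition admissible_sets ::
    "nat \<Rightarrow> real \<Rightarrow> 'a::euclidean_space set \<Rightarrow> ('a \<Rightarrow> real) set set" where
  "admissible_sets k p \<Omega> =
     {F. F \<subseteq> {u \<in> sobolev_space p \<Omega>. \<not> (AE x in lebesgue_on \<Omega>. u x = 0)} \<and>
         compactin (sobolev_topology p \<Omega>) (F \<inter> {u. lp_norm p \<Omega> u = 1}) \<and>
         F = uminus ` F \<and>
         genus (sobolev_topology p \<Omega>) F \<ge> enat k}"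

definition rayleigh_quotient :: "real \<Rightarrow> 'a::euclidean_space set \<Rightarrow> ('a \<Rightarrow> real) \<Rightarrow> real" where
  "rayleigh_quotient p \<Omega> u =
     (LINT x|lebesgue_on \<Omega>. norm (weak_gradient \<Omega> u x) powr p) /
     (LINT x|lebesgue_on \<Omega>. \<bar>u x\<bar> powr p)"

definition neumann_eigenvalue :: "nat \<Rightarrow> real \<Rightarrow> 'a::euclidean_space set \<Rightarrow> ereal" where
  "neumann_eigenvalue k p \<Omega> =
     (INF F\<in>admissible_sets k p \<Omega>. SUP u\<in>F. ereal (rayleigh_quotient p \<Omega> u))"

end

theory Submission
  imports Defs "HOL-Homology.Homology" "HOL-Computational_Algebra.Polynomial"
begin

text \<open>Choose \<open>r\<close> such that \<open>k\<close> balls of radius \<open>3r\<close> fill half of the volume of \<open>\<Omega>\<close>. A greedy choice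
  together with an averaging argument yields \<open>k\<close> disjoint balls of radius \<open>r\<close> whose intersections with
  \<open>\<Omega>\<close> have at most \<open>2\<^sup>n\<^sup>+\<^sup>2\<close> times the volume of the intersections of \<open>\<Omega>\<close> with the
  concentric balls of radius \<open>r/2\<close>. The \<open>C\<^sup>1\<close> bumps supported in these balls have Rayleigh quotient at most a
  constant times \<open>r\<^sup>-\<^sup>p\<close>. Because their supports are disjoint, the same bound holds for every nonzero
  linear combination, and by the Borsuk-Ulam theorem the set of these combinations has genus at
  least \<open>k\<close>.

  The Borsuk-Ulam theorem is proved with a cup product: an odd map \<open>f\<close> into
  \<open>\<real>\<^sup>l - {0}\<close> provides \<open>l\<close> representatives \<open>\<delta>b\<^sub>i\<close> of the generator of the first cohomology of
  projective space, \<open>b\<^sub>i\<close> being the sign of \<open>f\<^sub>i\<close>. Their product is odd on an \<open>l\<close>-dimensional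
  hemisphere, but it vanishes on every simplex on which some \<open>f\<^sub>i\<close> has constant sign, hence on
  fine subdivisions.\<close>

subsection \<open>The Borsuk-Ulam theorem\<close>

text \<open>The free abelian group on the type \<^typ>\<open>unit\<close> plays the role of \<open>\<int>\<close>, so that
  \<^const>\<open>frag_extend\<close> provides the additive extension of \<open>g\<close>.\<close>

definition cochain_eval :: "('a \<Rightarrow> int) \<Rightarrow> ('a \<Rightarrow>\<^sub>0 int) \<Rightarrow> int" where
  "cochain_eval g c =
     Poly_Mapping.lookup (frag_extend (\<lambda>x. frag_cmul (g x) (frag_of ())) c) ()"

lemma cochain_eval_0 [simp]: "cochain_eval g 0 = 0"
  by (simp add: cochain_eval_def)

lemma cochain_eval_of [simp]: "cochain_eval g (frag_of x) = g x"
  by (simp add: cochain_eval_def)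

lemma cochain_eval_diff: "cochain_eval g (a - b) = cochain_eval g a - cochain_eval g b"
  by (simp add: cochain_eval_def frag_extend_diff lookup_minus)

lemma cochain_eval_add: "cochain_eval g (a + b) = cochain_eval g a + cochain_eval g b"
  by (simp add: cochain_eval_def frag_extend_add lookup_add)

lemma cochain_eval_cmul: "cochain_eval g (frag_cmul k a) = k * cochain_eval g a"
  by (simp add: cochain_eval_def frag_extend_cmul)

lemma cochain_eval_sum: "cochain_eval g (sum f I) = (\<Sum>i\<in>I. cochain_eval g (f i))"
  by (induction I rule: infinite_finite_induct) (auto simp: cochain_eval_add)

lemma cochain_eval_cong:
  assumes "\<And>x. x \<in> Poly_Mapping.keys c \<Longrightarrow> g x = h x"
  shows "cochain_eval g c = cochain_eval h c"
  unfolding cochain_eval_def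
  by (intro arg_cong[where f = "\<lambda>c. Poly_Mapping.lookup c ()"] frag_extend_eq) (simp add: assms)

lemma cochain_eval_lincomb:
  "cochain_eval (\<lambda>x. k * g x + h x) c = k * cochain_eval g c + cochain_eval h c"
proof -
  have "Poly_Mapping.keys c \<subseteq> UNIV" by simp
  then show ?thesis
    by (induction c rule: frag_induction) (auto simp: cochain_eval_diff algebra_simps)
qed

lemma cochain_eval_scale: "cochain_eval (\<lambda>x. k * g x) c = k * cochain_eval g c"
proof -
  have "Poly_Mapping.keys c \<subseteq> UNIV" by simp
  then show ?thesis
    by (induction c rule: frag_induction) (auto simp: cochain_eval_diff algebra_simps)
qed

lemma cochain_eval_chain_map:
  "cochain_eval g (chain_map p h c) = cochain_eval (\<lambda>s. g (simplex_map p h s)) c"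
proof -
  have "Poly_Mapping.keys c \<subseteq> UNIV" by simp
  then show ?thesis
    by (induction c rule: frag_induction) (auto simp: cochain_eval_diff chain_map_diff)
qed

text \<open>The boundary is dual to the coboundary, the alternating sum of \<open>g\<close> over the
  faces; this turns identities between cochains into identities between their values on
  chains.\<close>

lemma cochain_eval_boundary:
  "cochain_eval g (chain_boundary (Suc p) c) =
     cochain_eval (\<lambda>s. \<Sum>k\<le>Suc p. (-1) ^ k * g (singular_face (Suc p) k s)) c"
proof -
  have "Poly_Mapping.keys c \<subseteq> UNIV" by simp
  then show ?thesis
  proof (induction c rule: frag_induction)
    case (one s)
    then show ?case
      unfolding chain_boundary_of cochain_eval_of
      by (simp only: if_False nat.distinct(2) cochain_eval_sum cochain_eval_cmul cochain_eval_of)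
  next
    case (diff a b)
    then show ?case by (simp only: cochain_eval_diff chain_boundary_diff)
  qed simp
qed

section \<open>Cup products of coboundaries of 0-cochains\<close>

text \<open>The value of the cup product \<open>\<delta>b\<^sub>0 \<union> \<dots> \<union> \<delta>b\<^sub>d\<^sub>-\<^sub>1\<close> on a simplex with ordered vertices
  \<open>x\<^sub>0, \<dots>, x\<^sub>d\<close>.\<close>

primrec cup_cobdry :: "(nat \<Rightarrow> 'a \<Rightarrow> int) \<Rightarrow> nat \<Rightarrow> (nat \<Rightarrow> 'a) \<Rightarrow> int" where
  "cup_cobdry b 0 x = 1"
| "cup_cobdry b (Suc d) x = (b 0 (x 1) - b 0 (x 0)) * cup_cobdry (b \<circ> Suc) d (x \<circ> Suc)"

text \<open>Models the passage from the ordered vertices of a simplex to those of its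
  \<open>k\<close>-th face.\<close>

definition omit :: "nat \<Rightarrow> (nat \<Rightarrow> 'a) \<Rightarrow> nat \<Rightarrow> 'a" where
  "omit k x i = x (if i < k then i else Suc i)"

lemma omit_0: "omit 0 x = x \<circ> Suc"
  by (auto simp: omit_def)

lemma omit_Suc: "omit (Suc k) x \<circ> Suc = omit k (x \<circ> Suc)"
  by (auto simp: omit_def)

text \<open>A product of cocycles is a cocycle. Removing vertex 0 or 1 changes the first factor; for
  \<open>k \<ge> 2\<close> it stays fixed and the induction hypothesis handles the other factors.
  The three resulting coefficients of \<open>?Q\<close> cancel.\<close>

lemma cup_cobdry_cocycle:
  "(\<Sum>k\<le>Suc d. (-1) ^ k * cup_cobdry b d (omit k x)) = 0"
proof (induction d arbitrary: b x)
  case 0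
  then show ?case by simp
next
  case (Suc d)
  let ?b = "b \<circ> Suc" and ?y = "x \<circ> Suc"
  let ?Q = "cup_cobdry ?b d (?y \<circ> Suc)"
  have IH: "(\<Sum>k\<le>d. (-1) ^ Suc k * cup_cobdry ?b d (omit (Suc k) ?y)) = - ?Q"
    using Suc[where b = ?b and x = ?y] unfolding sum.atMost_Suc_shift by (simp add: omit_0)
  have "(\<Sum>k\<le>Suc (Suc d). (-1) ^ k * cup_cobdry b (Suc d) (omit k x)) =
      (b 0 (x 2) - b 0 (x 1)) * ?Q - (b 0 (x 2) - b 0 (x 0)) * ?Q
      + (\<Sum>k\<le>d. (-1) ^ k * ((b 0 (x 1) - b 0 (x 0)) * cup_cobdry ?b d (omit (Suc k) ?y)))"
    unfolding sum.atMost_Suc_shift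
    by (simp add: omit_Suc omit_0 del: sum.atMost_Suc)
       (simp add: omit_def numeral_2_eq_2 comp_assoc del: sum.atMost_Suc)
  also have "(\<Sum>k\<le>d. (-1) ^ k * ((b 0 (x 1) - b 0 (x 0)) * cup_cobdry ?b d (omit (Suc k) ?y)))
      = - (b 0 (x 1) - b 0 (x 0)) * (\<Sum>k\<le>d. (-1) ^ Suc k * cup_cobdry ?b d (omit (Suc k) ?y))"
    unfolding sum_distrib_left by (intro sum.cong) (auto simp: algebra_simps)
  also have "(b 0 (x 2) - b 0 (x 1)) * ?Q - (b 0 (x 2) - b 0 (x 0)) * ?Q +
      - (b 0 (x 1) - b 0 (x 0)) * (\<Sum>k\<le>d. (-1) ^ Suc k * cup_cobdry ?b d (omit (Suc k) ?y)) = 0"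
    unfolding IH by (simp add: algebra_simps)
  finally show ?case .
qed

text \<open>The Leibniz rule reduces to one term because the remaining factors are cocycles: the
  face \<open>k = 0\<close> reads \<open>b 0\<close> at \<open>x 1\<close>, all others read it at
  \<open>x 0\<close>, and the cocycle identity collapses the latter to a single product.\<close>

lemma cup_cobdry_coboundary:
  "(\<Sum>k\<le>Suc d. (-1) ^ k * (b 0 (omit k x 0) * cup_cobdry (b \<circ> Suc) d (omit k x))) =
     cup_cobdry b (Suc d) x"
proof -
  let ?b = "b \<circ> Suc"
  have c: "(\<Sum>k\<le>d. (-1) ^ Suc k * cup_cobdry ?b d (omit (Suc k) x)) = - cup_cobdry ?b d (x \<circ> Suc)"
    using cup_cobdry_cocycle[where b = ?b and d = d and x = x]
    unfolding sum.atMost_Suc_shift by (simp add: omit_0)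
  have "(\<Sum>k\<le>Suc d. (-1) ^ k * (b 0 (omit k x 0) * cup_cobdry ?b d (omit k x))) =
    b 0 (x 1) * cup_cobdry ?b d (x \<circ> Suc)
    + b 0 (x 0) * (\<Sum>k\<le>d. (-1) ^ Suc k * cup_cobdry ?b d (omit (Suc k) x))"
    unfolding sum.atMost_Suc_shift sum_distrib_left
    by (simp add: omit_0 del: sum.atMost_Suc) (simp add: omit_def algebra_simps)
  also have "\<dots> = cup_cobdry b (Suc d) x"
    unfolding c by (simp add: algebra_simps)
  finally show ?thesis .
qed

lemma cup_cobdry_cong:
  assumes "\<And>i. i \<le> d \<Longrightarrow> x i = y i"
  shows "cup_cobdry b d x = cup_cobdry b d y"
  using assms
proof (induction d arbitrary: b x y)
  case (Suc d)
  have "cup_cobdry (b \<circ> Suc) d (x \<circ> Suc) = cup_cobdry (b \<circ> Suc) d (y \<circ> Suc)"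
    by (rule Suc.IH) (simp add: Suc.prems)
  then show ?case by (simp add: Suc.prems)
qed simp

text \<open>Each of the \<open>d\<close> differences changes sign under
  \<open>\<nu>\<close>.\<close>

lemma cup_cobdry_antisym:
  assumes "\<And>i j. j \<le> d \<Longrightarrow> b i (\<nu> (x j)) = 1 - b i (x j)"
  shows "cup_cobdry b d (\<lambda>i. \<nu> (x i)) = (-1) ^ d * cup_cobdry b d x"
  using assms
proof (induction d arbitrary: b x)
  case (Suc d)
  have "cup_cobdry (b \<circ> Suc) d (\<lambda>i. \<nu> ((x \<circ> Suc) i)) = (-1) ^ d * cup_cobdry (b \<circ> Suc) d (x \<circ> Suc)"
    by (rule Suc.IH) (use Suc.prems in auto)
  then show ?case
    by (simp add: o_def Suc.prems left_diff_distrib right_diff_distrib)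
qed simp

text \<open>Factor number \<open>i\<close> is the difference of \<open>b i\<close> along the edge
  from \<open>x i\<close> to \<open>x (Suc i)\<close>.\<close>

lemma cup_cobdry_eq_0:
  assumes "i < d" "b i (x (Suc i)) = b i (x i)"
  shows "cup_cobdry b d x = 0"
  using assms
proof (induction d arbitrary: b x i)
  case (Suc d)
  show ?case
  proof (cases i)
    case 0
    then show ?thesis using Suc.prems by simp
  next
    case (Suc j)
    then have "cup_cobdry (b \<circ> Suc) d (x \<circ> Suc) = 0"
      using Suc.prems by (intro Suc.IH[where i = j]) auto
    then show ?thesis by simp
  qed
qed simp

section \<open>Parity on an equivariant sequence of chains\<close>

abbreviation vertices :: "((nat \<Rightarrow> real) \<Rightarrow> 'a) \<Rightarrow> nat \<Rightarrow> 'a" where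
  "vertices s \<equiv> \<lambda>i. simplicial_vertex i s"

text \<open>\<open>simplical_face k\<close> sends unit vectors to unit vectors, skipping the index
  \<open>k\<close>. The bound \<open>i \<le> p\<close> keeps the vertex inside the simplex to which
  a singular face is restricted.\<close>

lemma vertices_singular_face:
  assumes "i \<le> p" "k \<le> Suc p"
  shows "vertices (singular_face (Suc p) k s) i = omit k (vertices s) i"
proof -
  have "simplical_face k (\<lambda>j. if j = i then 1 else 0) =
      (\<lambda>j. if j = (if i < k then i else Suc i) then 1 else (0::real))"
    by (rule ext) (auto simp: simplical_face_def)
  then show ?thesis
    using assms by (simp add: simplicial_vertex_def singular_face_def omit_def)
qed

lemma vertices_simplex_map:
  "i \<le> p \<Longrightarrow> vertices (simplex_map p h s) i = h (vertices s i)"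
  by (simp add: simplicial_vertex_def simplex_map_def)

lemma vertices_in_topspace:
  assumes "singular_simplex p X s" "i \<le> p"
  shows "vertices s i \<in> topspace X"
proof -
  have "s \<in> standard_simplex p \<rightarrow> topspace X"
    using assms(1) by (auto simp: singular_simplex_def continuous_map_def)
  then show ?thesis using assms(2) by (auto simp: simplicial_vertex_def)
qed

text \<open>Since \<open>\<delta>b\<^sub>0 \<union> \<dots> \<union> \<delta>b\<^sub>p\<close> is the coboundary of \<open>A = b\<^sub>0 \<union> \<delta>b\<^sub>1 \<union> \<dots> \<union> \<delta>b\<^sub>p\<close>, its value
  on \<open>c\<^sub>p\<^sub>+\<^sub>1\<close> is \<open>A(c\<^sub>p) \<plusminus> A(\<nu>c\<^sub>p)\<close>, which equals \<open>2A(c\<^sub>p)\<close> minus the value of the shorter product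
  \<open>\<delta>b\<^sub>1 \<union> \<dots> \<union> \<delta>b\<^sub>p\<close> on \<open>c\<^sub>p\<close>.\<close>

lemma odd_cup_cobdry_equivariant_chain:
  assumes ch: "\<And>p. p \<le> N \<Longrightarrow> singular_chain p X (c p)"
    and bd: "\<And>p. p < N \<Longrightarrow> chain_boundary (Suc p) (c (Suc p)) =
                 c p + frag_cmul ((-1) ^ Suc p) (chain_map p \<nu> (c p))"
    and c0: "c 0 = frag_of s"
    and b: "\<And>i y. y \<in> topspace X \<Longrightarrow> b i (\<nu> y) = 1 - b i y"
    and "p \<le> N"
  shows "odd (cochain_eval (\<lambda>s. cup_cobdry b p (vertices s)) (c p))"
  using \<open>p \<le> N\<close> b
proof (induction p arbitrary: b)
  case 0
  then show ?case by (simp add: c0)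
next
  case (Suc p)
  let ?b = "b \<circ> Suc"
  define A where "A s = b 0 (vertices s 0) * cup_cobdry ?b p (vertices s)" for s
  have "cochain_eval (\<lambda>s. cup_cobdry b (Suc p) (vertices s)) (c (Suc p)) =
      cochain_eval (\<lambda>s. \<Sum>k\<le>Suc p. (-1) ^ k * A (singular_face (Suc p) k s)) (c (Suc p))"
  proof (rule cochain_eval_cong)
    fix s
    have "A (singular_face (Suc p) k s) =
        b 0 (omit k (vertices s) 0) * cup_cobdry ?b p (omit k (vertices s))" if "k \<le> Suc p" for k
      unfolding A_def
      by (subst cup_cobdry_cong[where y = "omit k (vertices s)"])
         (use that in \<open>auto simp: vertices_singular_face\<close>)
    then show "cup_cobdry b (Suc p) (vertices s) =
        (\<Sum>k\<le>Suc p. (-1) ^ k * A (singular_face (Suc p) k s))"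
      by (subst cup_cobdry_coboundary[symmetric]) (intro sum.cong, auto)
  qed
  also have "\<dots> = cochain_eval A (chain_boundary (Suc p) (c (Suc p)))"
    by (rule cochain_eval_boundary[symmetric])
  also have "\<dots> = cochain_eval A (c p) + (-1) ^ Suc p * cochain_eval A (chain_map p \<nu> (c p))"
    using Suc.prems by (simp only: bd Suc_le_lessD cochain_eval_add cochain_eval_cmul)
  also have "cochain_eval A (chain_map p \<nu> (c p)) =
      cochain_eval (\<lambda>s. - ((-1) ^ p) * A s + (-1) ^ p * cup_cobdry ?b p (vertices s)) (c p)"
    unfolding cochain_eval_chain_map
  proof (rule cochain_eval_cong)
    fix s assume "s \<in> Poly_Mapping.keys (c p)"
    then have s: "singular_simplex p X s"
      using ch[of p] Suc.prems by (auto simp: singular_chain_def)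
    have "cup_cobdry ?b p (vertices (simplex_map p \<nu> s)) = cup_cobdry ?b p (\<lambda>i. \<nu> (vertices s i))"
      by (rule cup_cobdry_cong) (simp add: vertices_simplex_map)
    also have "\<dots> = (-1) ^ p * cup_cobdry ?b p (vertices s)"
      by (rule cup_cobdry_antisym) (use s vertices_in_topspace Suc.prems in fastforce)
    finally show "A (simplex_map p \<nu> s) =
        - ((-1) ^ p) * A s + (-1) ^ p * cup_cobdry ?b p (vertices s)"
      by (simp add: A_def vertices_simplex_map vertices_in_topspace[OF s] Suc.prems(2)
          left_diff_distrib right_diff_distrib)
  qed
  also have "\<dots> = - ((-1) ^ p) * cochain_eval A (c p)
      + (-1) ^ p * cochain_eval (\<lambda>s. cup_cobdry ?b p (vertices s)) (c p)"
    by (simp only: cochain_eval_lincomb cochain_eval_scale)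
  \<comment> \<open>The sign in the boundary relation and the sign \<open>(-1) ^ p\<close> from the
    antisymmetry multiply to -1, so the two copies of \<open>cochain_eval A (c p)\<close> add up to
    an even number instead of cancelling.\<close>
  finally have "cochain_eval (\<lambda>s. cup_cobdry b (Suc p) (vertices s)) (c (Suc p)) =
      2 * cochain_eval A (c p) - cochain_eval (\<lambda>s. cup_cobdry ?b p (vertices s)) (c p)"
    by (cases "even p") auto
  moreover have "odd (cochain_eval (\<lambda>s. cup_cobdry ?b p (vertices s)) (c p))"
    by (rule Suc.IH) (use Suc.prems in auto)
  ultimately show ?case by simp
qed

section \<open>Equivariant chains on spheres\<close>

abbreviation unit_coord :: "nat \<Rightarrow> nat \<Rightarrow> real" where
  "unit_coord p \<equiv> \<lambda>i. if i = p then 1 else 0"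

text \<open>The upper hemispheres of the boundary of the cross polytope: each is the cone, with apex the
  next coordinate vector, over the full sphere of one dimension less.\<close>

primrec hemisphere_chain :: "nat \<Rightarrow> (nat \<Rightarrow> real) chain" where
  "hemisphere_chain 0 = frag_of (oriented_simplex 0 (\<lambda>_. unit_coord 0))"
| "hemisphere_chain (Suc p) = simplicial_cone p (unit_coord (Suc p))
     (hemisphere_chain p + frag_cmul ((-1) ^ Suc p) (chain_map p uminus (hemisphere_chain p)))"

abbreviation sphere_chain :: "nat \<Rightarrow> (nat \<Rightarrow> real) chain" where
  "sphere_chain p \<equiv>
     hemisphere_chain p + frag_cmul ((-1) ^ Suc p) (chain_map p uminus (hemisphere_chain p))"

text \<open>Euclidean space of dimension \<open>p + 1\<close> without the origin, standing in for
  the \<open>p\<close>-sphere. It is the carrier of \<open>punctured_space (Suc p)\<close>, so the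
  indices differ by one.\<close>

definition punctured :: "nat \<Rightarrow> (nat \<Rightarrow> real) set" where
  "punctured p = {x. x \<noteq> (\<lambda>i. 0) \<and> (\<forall>i>p. x i = 0)}"

lemma uminus_punctured: "x \<in> punctured p \<Longrightarrow> - x \<in> punctured p"
  by (auto simp: punctured_def fun_eq_iff)

lemma simplicial_chain_uminus:
  assumes "simplicial_chain p S c" "\<And>x. x \<in> S \<Longrightarrow> - x \<in> S"
  shows "simplicial_chain p S (chain_map p uminus c)"
proof -
  have "simplicial_simplex p S (simplex_map p uminus f)" if f: "simplicial_simplex p S f" for f
  proof -
    obtain l where l: "f = oriented_simplex p l" and im: "f ` standard_simplex p \<subseteq> S"
      using f by (auto simp: simplicial_simplex)
    have "simplex_map p uminus f = oriented_simplex p (- l)"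
      by (auto simp: simplex_map_def l oriented_simplex_def fun_eq_iff sum_negf)
    moreover have "simplex_map p uminus f ` standard_simplex p \<subseteq> S"
      using im assms(2) by (auto simp: simplex_map_def)
    ultimately show ?thesis unfolding simplicial_simplex by blast
  qed
  with assms(1) show ?thesis
    unfolding simplicial_chain_def chain_map_def
    using keys_frag_extend[of "frag_of \<circ> simplex_map p uminus" c] by fastforce
qed

lemma simplicial_chain_sphere_chain:
  assumes "simplicial_chain p (punctured p) (hemisphere_chain p)"
  shows "simplicial_chain p (punctured p) (sphere_chain p)"
proof -
  have "simplicial_chain p (punctured p) (frag_cmul k (chain_map p uminus (hemisphere_chain p)))" for k
    by (intro simplicial_chain_cmul simplicial_chain_uminus assms uminus_punctured)
  from simplicial_chain_diff[OF assms this[of "(-1) ^ p"]] show ?thesis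
    by (cases "even p") simp_all
qed

text \<open>On the cone the coordinate \<open>Suc p\<close> equals \<open>1 - u\<close>, so it is
  nonzero until \<open>u = 1\<close>, where the point lies in the base, which avoids the
  origin.\<close>

lemma simplicial_chain_hemisphere_chain:
  "simplicial_chain p (punctured p) (hemisphere_chain p)"
proof (induction p)
  case 0
  have "oriented_simplex 0 (\<lambda>_. unit_coord 0) ` standard_simplex 0 \<subseteq> punctured 0"
    by (auto simp: oriented_simplex_def standard_simplex_0 punctured_def fun_eq_iff)
  then show ?case by (auto simp: simplicial_simplex)
next
  case (Suc p)
  show ?case
    unfolding hemisphere_chain.simps
  proof (rule simplicial_chain_simplicial_cone[OF simplicial_chain_sphere_chain[OF Suc]])
    fix x u assume u: "0 \<le> (u::real)" "u \<le> 1" and x: "x \<in> punctured p"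
    show "(\<lambda>i. (1 - u) * unit_coord (Suc p) i + u * x i) \<in> punctured (Suc p)"
    proof (cases "u = 1")
      case True
      with x show ?thesis by (auto simp: punctured_def)
    next
      case False
      with x have "(1 - u) * unit_coord (Suc p) (Suc p) + u * x (Suc p) \<noteq> 0"
        by (simp add: punctured_def)
      with x show ?thesis by (force simp: punctured_def fun_eq_iff)
    qed
  qed
qed

text \<open>The boundary of a cone over a cycle is that cycle. \<open>sphere_chain\<close> is a
  cycle because the antipodal map is an involution commuting with the boundary, so that the
  boundaries of the two hemispheres cancel. In dimension 0 the extra term of the cone formula counts
  points with sign, and the two points cancel.\<close>

lemma chain_boundary_hemisphere_chain:
  "chain_boundary (Suc p) (hemisphere_chain (Suc p)) = sphere_chain p"
proof (induction p)
  case 0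
  have "chain_boundary (Suc 0) (hemisphere_chain (Suc 0)) =
      sphere_chain 0 - frag_extend (\<lambda>f. frag_of (\<lambda>u\<in>standard_simplex 0. unit_coord (Suc 0))) (sphere_chain 0)"
    using chain_boundary_simplicial_cone[OF simplicial_chain_sphere_chain
        [OF simplicial_chain_hemisphere_chain[of 0]], of "unit_coord (Suc 0)"] by simp
  also have "frag_extend (\<lambda>f. frag_of (\<lambda>u\<in>standard_simplex 0. unit_coord (Suc 0))) (sphere_chain 0) = 0"
    by (simp add: frag_extend_diff frag_extend_add frag_extend_minus)
  finally show ?case by simp
next
  case (Suc p)
  let ?c = "hemisphere_chain" and ?\<nu> = "\<lambda>p. chain_map p (uminus :: (nat \<Rightarrow> real) \<Rightarrow> _)"
  have sing: "singular_chain p (subtopology (powertop_real UNIV) (punctured p)) (?c p)" for p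
    by (rule simplicial_imp_singular_chain[OF simplicial_chain_hemisphere_chain])
  have inv: "?\<nu> p (?\<nu> p (?c p)) = ?c p"
  proof -
    have "?\<nu> p (?\<nu> p (?c p)) = chain_map p (uminus \<circ> uminus) (?c p)"
      by (simp add: chain_map_compose)
    also have "\<dots> = ?c p"
      by (rule chain_map_id_gen[OF sing]) (simp add: fun_eq_iff)
    finally show ?thesis .
  qed
  have "chain_boundary (Suc p) (sphere_chain (Suc p)) =
      sphere_chain p + frag_cmul ((-1) ^ Suc (Suc p)) (?\<nu> p (sphere_chain p))"
    using Suc.IH chain_boundary_chain_map[OF sing[of "Suc p"], of uminus]
    by (simp only: chain_boundary_add chain_boundary_cmul diff_Suc_Suc diff_zero)
  also have "?\<nu> p (sphere_chain p) = ?\<nu> p (?c p) + frag_cmul ((-1) ^ Suc p) (?c p)"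
    by (simp only: chain_map_add chain_map_cmul inv)
  also have "sphere_chain p + frag_cmul ((-1) ^ Suc (Suc p))
      (?\<nu> p (?c p) + frag_cmul ((-1) ^ Suc p) (?c p)) = 0"
    by (cases "even p") (simp_all add: frag_cmul_distrib2)
  finally have "chain_boundary (Suc p) (sphere_chain (Suc p)) = 0" .
  moreover have "chain_boundary (Suc (Suc p)) (?c (Suc (Suc p))) =
      sphere_chain (Suc p) -
      simplicial_cone p (unit_coord (Suc (Suc p))) (chain_boundary (Suc p) (sphere_chain (Suc p)))"
    using chain_boundary_simplicial_cone[OF simplicial_chain_sphere_chain
        [OF simplicial_chain_hemisphere_chain[of "Suc p"]], of "unit_coord (Suc (Suc p))"]
    by (simp only: hemisphere_chain.simps(2)[of "Suc p"]) simp
  moreover have "simplicial_cone p (unit_coord (Suc (Suc p))) 0 = 0"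
    by (simp add: simplicial_cone_def)
  ultimately show ?case
    by (simp only: diff_zero)
qed

section \<open>Odd maps between punctured Euclidean spaces\<close>

abbreviation punctured_space :: "nat \<Rightarrow> (nat \<Rightarrow> real) topology" where
  "punctured_space k \<equiv> subtopology (Euclidean_space k) (- {\<lambda>i. 0})"

text \<open>If \<open>l < k\<close>, the hemisphere chains up to dimension \<open>l\<close> lie in
  the domain. Iterated subdivision keeps their boundary relations and makes the simplices of the top
  one so small that on each of them some component of \<open>f\<close> has constant sign. The cup
  product is then both odd and zero.\<close>

theorem Borsuk_Ulam_punctured_space:
  assumes cont: "continuous_map (punctured_space k) (punctured_space l) f"
    and odd: "\<And>x. x \<in> topspace (punctured_space k) \<Longrightarrow> f (- x) = - f x"
  shows "k \<le> l"
proof (rule ccontr)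
  assume "\<not> k \<le> l"
  let ?X = "punctured_space k" and ?sd = "\<lambda>p. singular_subdivision p :: (nat \<Rightarrow> real) chain \<Rightarrow> _"
  have tX: "topspace ?X = {x. x \<noteq> (\<lambda>i. 0) \<and> (\<forall>i\<ge>k. x i = 0)}"
    by (auto simp: topspace_Euclidean_space)
  have fX: "f x \<noteq> (\<lambda>i. 0)" "\<And>i. i \<ge> l \<Longrightarrow> f x i = 0" if "x \<in> topspace ?X" for x
  proof -
    have "f x \<in> topspace (punctured_space l)"
      using continuous_map_image_subset_topspace[OF cont] that by blast
    then show "f x \<noteq> (\<lambda>i. 0)" "\<And>i. i \<ge> l \<Longrightarrow> f x i = 0"
      by (auto simp: topspace_Euclidean_space)
  qed
  have sing: "singular_chain p ?X (hemisphere_chain p)" if "p \<le> l" for p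
  proof -
    have "singular_chain p (subtopology (powertop_real UNIV) (punctured p)) (hemisphere_chain p)"
      by (rule simplicial_imp_singular_chain[OF simplicial_chain_hemisphere_chain])
    moreover have "punctured p \<subseteq> {x. \<forall>i\<ge>k. x i = 0} \<inter> - {\<lambda>i. 0}"
      using \<open>p \<le> l\<close> \<open>\<not> k \<le> l\<close> by (auto simp: punctured_def)
    ultimately show ?thesis
      by (auto simp: Euclidean_space_def subtopology_subtopology singular_chain_subtopology)
  qed
  \<comment> \<open>As \<open>f x\<close> is nonzero and vanishes from index \<open>l\<close> on,
    one of its first \<open>l\<close> components is nonzero; hence these open sets cover the
    domain.\<close>
  define cover where "cover = (\<Union>i<l. {{x \<in> topspace ?X. f x i > 0}, {x \<in> topspace ?X. f x i < 0}})"
  have comp: "continuous_map ?X euclideanreal (\<lambda>x. f x i)" for i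
  proof -
    have "continuous_map ?X (powertop_real UNIV) f"
      using cont by (simp add: Euclidean_space_def continuous_map_in_subtopology)
    then show ?thesis by (simp add: continuous_map_componentwise_UNIV)
  qed
  have "openin ?X U" if "U \<in> cover" for U
    using that comp[THEN openin_continuous_map_preimage, of "{0<..}"]
      comp[THEN openin_continuous_map_preimage, of "{..<0}"]
    by (auto simp: cover_def)
  moreover have "topspace ?X \<subseteq> \<Union>cover"
  proof
    fix x assume x: "x \<in> topspace ?X"
    then obtain i where "f x i \<noteq> 0" using fX(1) by (meson ext)
    moreover have "i < l" using fX(2)[OF x] calculation by (meson not_less)
    ultimately show "x \<in> \<Union>cover"
      using x unfolding cover_def
      by (auto simp del: topspace_subtopology intro!: bexI[of _ i])
  qed
  ultimately obtain m where m: "\<And>s. s \<in> Poly_Mapping.keys ((?sd l ^^ m) (hemisphere_chain l))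
      \<Longrightarrow> \<exists>V\<in>cover. s \<in> standard_simplex l \<rightarrow> V"
    using sufficient_iterated_singular_subdivision_exists[OF _ _ sing[OF order_refl]]
    by (metis order_refl)
  \<comment> \<open>All dimensions are subdivided the same number of times, so the chains remain
    linked by the boundary relation.\<close>
  define c where "c p = (?sd p ^^ m) (hemisphere_chain p)" for p
  have sdsing: "singular_chain p ?X ((?sd p ^^ j) (hemisphere_chain p))" if "p \<le> l" for p j
    by (induction j) (use that in \<open>auto simp: sing singular_chain_singular_subdivision\<close>)
  have csing: "singular_chain p ?X (c p)" if "p \<le> l" for p
    unfolding c_def by (rule sdsing[OF that])
  have cm: "continuous_map ?X ?X uminus"
  proof -
    have "continuous_map ?X (powertop_real UNIV) uminus"
      unfolding continuous_map_componentwise_UNIV Euclidean_space_def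
      by (auto intro!: continuous_intros continuous_map_from_subtopology continuous_map_product_projection)
    then show ?thesis
      by (auto simp: Euclidean_space_def subtopology_subtopology continuous_map_in_subtopology fun_eq_iff)
  qed
  \<comment> \<open>Subdivision commutes with the boundary and, being natural, with the antipodal
    map.\<close>
  have bd: "chain_boundary (Suc p) ((?sd (Suc p) ^^ j) (hemisphere_chain (Suc p))) =
      (?sd p ^^ j) (hemisphere_chain p) +
      frag_cmul ((-1) ^ Suc p) (chain_map p uminus ((?sd p ^^ j) (hemisphere_chain p)))"
    if "p < l" for p j
  proof (induction j)
    case 0
    show ?case by (simp only: funpow_0 chain_boundary_hemisphere_chain)
  next
    case (Suc j)
    let ?h = "(?sd p ^^ j) (hemisphere_chain p)"
    have "chain_boundary (Suc p) (?sd (Suc p) ((?sd (Suc p) ^^ j) (hemisphere_chain (Suc p)))) =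
      ?sd p (chain_boundary (Suc p) ((?sd (Suc p) ^^ j) (hemisphere_chain (Suc p))))"
      using chain_boundary_singular_subdivision[OF sdsing[of "Suc p" j]] that by simp
    also have "\<dots> = ?sd p (?h + frag_cmul ((-1) ^ Suc p) (chain_map p uminus ?h))"
      by (simp only: Suc)
    also have "\<dots> = ?sd p ?h + frag_cmul ((-1) ^ Suc p) (?sd p (chain_map p uminus ?h))"
      by (simp only: singular_subdivision_add) (simp only: singular_subdivision_def frag_extend_cmul)
    also have "?sd p (chain_map p uminus ?h) = chain_map p uminus (?sd p ?h)"
      by (rule naturality_singular_subdivision[OF sdsing]) (use that in simp)
    finally show ?case by (simp only: funpow.simps o_apply)
  qed
  \<comment> \<open>Subdivision fixes this 0-chain, so the parity induction still starts from a
    single point.\<close>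
  have c0: "c 0 = frag_of (oriented_simplex 0 (\<lambda>_. unit_coord 0))"
  proof -
    have "(?sd 0 ^^ j) (hemisphere_chain 0) = hemisphere_chain 0" for j
      by (induction j) (use sing[of 0] in \<open>auto simp: singular_subdivision_zero\<close>)
    then show ?thesis by (simp add: c_def)
  qed
  \<comment> \<open>\<open>b\<^sub>i\<close> is the sign of the \<open>i\<close>-th component of \<open>f\<close>; where that component vanishes, an arbitrary
    odd sign function takes over. On a simplex lying in \<open>{f\<^sub>i > 0}\<close> or \<open>{f\<^sub>i < 0}\<close> the factor
    \<open>\<delta>b\<^sub>i\<close> is zero.\<close>
  define a where "a x = x (LEAST i. x i \<noteq> (0::real))" for x :: "nat \<Rightarrow> real"
  have a0: "a x \<noteq> 0" if x: "x \<in> topspace ?X" for x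
  proof -
    obtain j where "x j \<noteq> 0" using x unfolding tX by (auto simp: fun_eq_iff)
    then show ?thesis unfolding a_def by (rule LeastI)
  qed
  have am: "a (- x) = - a x" for x by (simp add: a_def)
  define b where "b i x = (of_bool ((if f x i = 0 then a x else f x i) > 0) :: int)" for i x
  have bm: "b i (- x) = 1 - b i x" if "x \<in> topspace ?X" for i x
    using a0[OF that] odd[OF that] by (auto simp: b_def am)
  have parity: "odd (cochain_eval (\<lambda>s. cup_cobdry b l (vertices s)) (c l))"
  proof (rule odd_cup_cobdry_equivariant_chain[where N = l and X = ?X and \<nu> = uminus])
    show "chain_boundary (Suc p) (c (Suc p)) =
        c p + frag_cmul ((-1) ^ Suc p) (chain_map p uminus (c p))" if "p < l" for p
      unfolding c_def by (rule bd[OF that])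
    show "c 0 = frag_of (oriented_simplex 0 (\<lambda>_. unit_coord 0))" by (rule c0)
    show "b i (- y) = 1 - b i y" if "y \<in> topspace ?X" for i y by (rule bm[OF that])
  qed (use csing in auto)
  have "cochain_eval (\<lambda>s. cup_cobdry b l (vertices s)) (c l) = cochain_eval (\<lambda>s. 0) (c l)"
  proof (rule cochain_eval_cong)
    fix s assume "s \<in> Poly_Mapping.keys (c l)"
    then obtain V where V: "V \<in> cover" "s \<in> standard_simplex l \<rightarrow> V"
      using m by (auto simp: c_def)
    have vert: "vertices s j \<in> V" if "j \<le> l" for j
      using V(2) that by (auto simp: simplicial_vertex_def)
    obtain i where i: "i < l"
      "V = {x \<in> topspace ?X. f x i > 0} \<or> V = {x \<in> topspace ?X. f x i < 0}"
      using V(1) by (auto simp: cover_def simp del: topspace_subtopology)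
    then have "b i (vertices s (Suc i)) = b i (vertices s i)"
      using vert[of i] vert[of "Suc i"] by (auto simp: b_def)
    then show "cup_cobdry b l (vertices s) = 0"
      using cup_cobdry_eq_0 i(1) by metis
  qed
  also have "\<dots> = 0" using cochain_eval_scale[of 0 "\<lambda>s. 0"] by simp
  finally show False using parity by simp
qed

subsection \<open>Smooth bump functions\<close>

abbreviation tcd :: "nat \<Rightarrow> ('a::real_normed_vector \<Rightarrow> 'b::real_normed_vector) \<Rightarrow> bool" where
  "tcd m f \<equiv> times_cont_differentiable_on m UNIV f"

lemma tcd_SucI:
  assumes "\<And>x. (f has_derivative f' x) (at x)" "\<And>v. tcd m (\<lambda>x. f' x v)"
  shows "tcd (Suc m) f"
proof -
  have "frechet_derivative f (at x) = f' x" for x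
    using frechet_derivative_at[OF assms(1)] by simp
  with assms show ?thesis by (auto simp: differentiable_def)
qed

lemma tcd_SucD: "tcd (Suc m) f \<Longrightarrow> tcd m f"
proof (induction m arbitrary: f)
  case 0
  then show ?case
    by (auto intro!: differentiable_imp_continuous_on simp: differentiable_on_def)
next
  case (Suc m)
  from Suc.prems have "f differentiable (at x)" "tcd (Suc m) (\<lambda>x. frechet_derivative f (at x) v)" for x v
    by (simp_all only: times_cont_differentiable_on.simps UNIV_I Ball_def simp_thms)
  with Suc.IH show ?case
    by (simp only: times_cont_differentiable_on.simps(2)) blast
qed

lemma tcd_Suc_has_derivative:
  assumes "tcd (Suc m) f"
  shows "(f has_derivative frechet_derivative f (at x)) (at x)"
    "tcd m (\<lambda>x. frechet_derivative f (at x) v)"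
  using assms by (auto simp: frechet_derivative_works)

lemma tcd_const: "tcd m (\<lambda>x. c)"
proof (induction m arbitrary: c)
  case (Suc m)
  show ?case by (rule tcd_SucI[where f' = "\<lambda>x v. 0"]) (auto intro: Suc)
qed simp

lemma tcd_inner_right: "tcd m (\<lambda>x. x \<bullet> b)"
proof (cases m)
  case (Suc k)
  show ?thesis unfolding Suc
    by (rule tcd_SucI[where f' = "\<lambda>x v. v \<bullet> b"]) (auto intro!: derivative_eq_intros tcd_const)
qed (auto intro!: continuous_intros)

lemma tcd_add: "tcd m f \<Longrightarrow> tcd m g \<Longrightarrow> tcd m (\<lambda>x. f x + g x)"
proof (induction m arbitrary: f g)
  case (Suc m)
  show ?case
    by (rule tcd_SucI[OF has_derivative_add[OF tcd_Suc_has_derivative(1)[OF Suc.prems(1)]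
          tcd_Suc_has_derivative(1)[OF Suc.prems(2)]]])
       (intro Suc.IH tcd_Suc_has_derivative(2) Suc.prems)
qed (auto intro: continuous_intros)

lemma tcd_mult:
  fixes f g :: "'a::real_normed_vector \<Rightarrow> real"
  shows "tcd m f \<Longrightarrow> tcd m g \<Longrightarrow> tcd m (\<lambda>x. f x * g x)"
proof (induction m arbitrary: f g)
  case (Suc m)
  show ?case
    by (rule tcd_SucI[OF has_derivative_mult[OF tcd_Suc_has_derivative(1)[OF Suc.prems(1)]
          tcd_Suc_has_derivative(1)[OF Suc.prems(2)]]])
       (intro tcd_add Suc.IH tcd_Suc_has_derivative(2) Suc.prems tcd_SucD[OF Suc.prems(1)]
          tcd_SucD[OF Suc.prems(2)])
qed (auto intro: continuous_intros)

text \<open>The functions \<open>P(1/t) exp(-1/t)\<close>, extended by zero to \<open>t \<le> 0\<close>, are closed under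
  differentiation.\<close>

definition flat_exp :: "real poly \<Rightarrow> real \<Rightarrow> real" where
  "flat_exp P t = (if t > 0 then poly P (1 / t) * exp (- (1 / t)) else 0)"

lemma poly_times_exp_minus_tendsto_0: "((\<lambda>y. poly P y * exp (- y)) \<longlongrightarrow> (0::real)) at_top"
proof -
  have "((\<lambda>y. \<Sum>i\<le>Polynomial.degree P. Polynomial.coeff P i * (y ^ i / exp y)) \<longlongrightarrow> (\<Sum>i\<le>Polynomial.degree P. Polynomial.coeff P i * 0)) at_top"
    by (intro tendsto_intros tendsto_power_div_exp_0)
  then show ?thesis
    by (simp add: poly_altdef sum_distrib_right exp_minus divide_inverse mult.assoc)
qed

lemma flat_exp_tendsto_0: "(flat_exp P \<longlongrightarrow> 0) (at 0)"
proof -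
  have "((\<lambda>t. poly P (inverse t) * exp (- inverse t)) \<longlongrightarrow> 0) (at_right 0)"
    by (rule filterlim_compose[OF poly_times_exp_minus_tendsto_0 filterlim_inverse_at_top_right])
  moreover have "\<forall>\<^sub>F t in at_right 0. poly P (inverse t) * exp (- inverse t) = flat_exp P t"
    by (auto simp: eventually_at_filter flat_exp_def divide_inverse)
  ultimately have "(flat_exp P \<longlongrightarrow> 0) (at_right 0)"
    by (blast intro: Lim_transform_eventually)
  moreover have "(flat_exp P \<longlongrightarrow> 0) (at_left 0)"
    by (rule tendsto_eventually) (auto simp: eventually_at_filter flat_exp_def)
  ultimately show ?thesis by (simp add: filterlim_at_split)
qed

text \<open>For \<open>t > 0\<close> the derivative is
  \<open>(1/t)^2 (P - P')(1/t) exp(-1/t)\<close>, and the square is the factor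
  \<open>[:0, 0, 1:]\<close> in the variable \<open>1/t\<close>.\<close>

lemma DERIV_flat_exp:
  "(flat_exp P has_real_derivative flat_exp ([:0, 0, 1:] * (P - pderiv P)) t) (at t)"
proof -
  consider "t > 0" | "t < 0" | "t = 0" by linarith
  then show ?thesis
  proof cases
    case 1
    have "((\<lambda>t. poly P (1 / t) * exp (- (1 / t))) has_real_derivative
        flat_exp ([:0, 0, 1:] * (P - pderiv P)) t) (at t)"
      using 1
      by (auto intro!: derivative_eq_intros DERIV_chain2[OF poly_DERIV]
          simp: flat_exp_def power2_eq_square field_simps)
    then show ?thesis
      by (rule has_field_derivative_transform_within[where d = t])
         (use 1 in \<open>auto simp: flat_exp_def dist_real_def\<close>)
  next
    case 2
    have "((\<lambda>t. 0) has_real_derivative 0) (at t)" by simp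
    then have "(flat_exp P has_real_derivative 0) (at t)"
      by (rule has_field_derivative_transform_within[where d = "- t"])
         (use 2 in \<open>auto simp: flat_exp_def dist_real_def\<close>)
    then show ?thesis using 2 by (simp add: flat_exp_def)
  next
    case 3
    \<comment> \<open>Dividing by \<open>h\<close> multiplies the polynomial in \<open>1/h\<close>
      by its variable, so the difference quotient at 0 belongs to the same class and tends to
      0.\<close>
    have "(\<lambda>h. (flat_exp P (0 + h) - flat_exp P 0) / h) = flat_exp (pCons 0 P)"
      by (auto simp: flat_exp_def fun_eq_iff)
    then have "(flat_exp P has_real_derivative 0) (at 0)"
      using flat_exp_tendsto_0[of "pCons 0 P"] unfolding DERIV_def by simp
    then show ?thesis using 3 by (simp add: flat_exp_def)
  qed
qed

text \<open>The induction keeps \<open>P\<close> arbitrary, since differentiation brings in a new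
  polynomial.\<close>

lemma tcd_flat_exp:
  fixes q :: "'a::real_normed_vector \<Rightarrow> real"
  shows "tcd m q \<Longrightarrow> tcd m (\<lambda>x. flat_exp P (q x))"
proof (induction m arbitrary: P q)
  case 0
  have "continuous_on UNIV (flat_exp P)"
    using DERIV_flat_exp by (intro continuous_at_imp_continuous_on) (blast intro: DERIV_isCont)
  with 0 show ?case
    by (auto intro: continuous_on_compose2)
next
  case (Suc m)
  let ?Q = "[:0, 0, 1:] * (P - pderiv P)"
  show ?case
  proof (rule tcd_SucI[where f' = "\<lambda>x v. flat_exp ?Q (q x) * frechet_derivative q (at x) v"])
    fix x
    have "((\<lambda>x. flat_exp P (q x)) has_derivative
       (\<lambda>v. frechet_derivative q (at x) v * flat_exp ?Q (q x))) (at x)"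
      using DERIV_compose_FDERIV[OF DERIV_flat_exp tcd_Suc_has_derivative(1)[OF Suc.prems]] .
    then show "((\<lambda>x. flat_exp P (q x)) has_derivative
       (\<lambda>v. flat_exp ?Q (q x) * frechet_derivative q (at x) v)) (at x)"
      by (simp add: mult.commute)
  next
    fix v
    show "tcd m (\<lambda>x. flat_exp ?Q (q x) * frechet_derivative q (at x) v)"
      by (intro tcd_mult Suc.IH tcd_SucD[OF Suc.prems] tcd_Suc_has_derivative(2)[OF Suc.prems])
  qed
qed

section \<open>Smooth approximation of indicators of boxes\<close>

text \<open>The factor \<open>Suc j\<close> steepens the profile \<open>exp(-1/t)\<close>: with
  growing \<open>j\<close> these functions, bounded by 1 and supported in the box, converge to the
  indicator of the open box.\<close>

definition box_bump :: "'a::euclidean_space \<Rightarrow> 'a \<Rightarrow> nat \<Rightarrow> 'a \<Rightarrow> real" where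
  "box_bump a c j x = (\<Prod>b\<in>Basis. flat_exp 1 (real (Suc j) * (x \<bullet> b - a \<bullet> b)) *
                                  flat_exp 1 (real (Suc j) * (c \<bullet> b - x \<bullet> b)))"

lemma flat_exp_1_nonneg: "flat_exp 1 t \<ge> 0"
  and flat_exp_1_le_1: "flat_exp 1 t \<le> 1"
  by (auto simp: flat_exp_def)

lemma flat_exp_1_tendsto:
  "(\<lambda>j. flat_exp 1 (real (Suc j) * s)) \<longlonglongrightarrow> indicator {0<..} s"
proof (cases "s > 0")
  case True
  have "(\<lambda>j. exp (- (inverse (real (Suc j)) * (1 / s)))) \<longlonglongrightarrow> exp (- (0 * (1 / s)))"
    by (intro tendsto_intros LIMSEQ_inverse_real_of_nat)
  moreover have "flat_exp 1 (real (Suc j) * s) = exp (- (inverse (real (Suc j)) * (1 / s)))" for j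
    using True by (simp add: flat_exp_def divide_inverse del: of_nat_Suc)
  ultimately show ?thesis using True by simp
next
  case False
  then have "\<not> real (Suc j) * s > 0" for j
    by (simp add: mult_le_0_iff not_less)
  with False show ?thesis by (simp add: flat_exp_def)
qed

lemma box_bump_bounds: "0 \<le> box_bump a c j x" "box_bump a c j x \<le> 1"
  unfolding box_bump_def
  by (auto intro!: prod_nonneg prod_le_1 mult_le_one simp: flat_exp_1_nonneg flat_exp_1_le_1)

lemma box_bump_eq_0: "x \<notin> box a c \<Longrightarrow> box_bump a c j x = 0"
proof -
  assume "x \<notin> box a c"
  then obtain b where b: "b \<in> Basis" "x \<bullet> b - a \<bullet> b \<le> 0 \<or> c \<bullet> b - x \<bullet> b \<le> 0"
    by (auto simp: mem_box not_less)
  then have "\<not> real (Suc j) * (x \<bullet> b - a \<bullet> b) > 0 \<or> \<not> real (Suc j) * (c \<bullet> b - x \<bullet> b) > 0"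
    by (simp only: zero_less_mult_iff) auto
  then show ?thesis
    unfolding box_bump_def by (intro prod_zero bexI[OF _ b(1)]) (auto simp: flat_exp_def)
qed

lemma box_bump_tendsto: "(\<lambda>j. box_bump a c j x) \<longlonglongrightarrow> indicator (box a c) x"
proof -
  have "(\<lambda>j. box_bump a c j x) \<longlonglongrightarrow>
      (\<Prod>b\<in>Basis. indicator {0<..} (x \<bullet> b - a \<bullet> b) * indicator {0<..} (c \<bullet> b - x \<bullet> b))"
    unfolding box_bump_def by (intro tendsto_intros flat_exp_1_tendsto)
  also have "(\<Prod>b\<in>Basis. indicator {0<..} (x \<bullet> b - a \<bullet> b) * indicator {0<..} (c \<bullet> b - x \<bullet> b)) =
      (indicator (box a c) x :: real)"
  proof (cases "x \<in> box a c")
    case True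
    then show ?thesis by (auto simp: mem_box intro!: prod.neutral)
  next
    case False
    then obtain b where b: "b \<in> Basis" "\<not> x \<bullet> b - a \<bullet> b > 0 \<or> \<not> c \<bullet> b - x \<bullet> b > 0"
      by (auto simp: mem_box)
    then have "(\<Prod>b\<in>Basis. indicator {0<..} (x \<bullet> b - a \<bullet> b) * indicator {0<..} (c \<bullet> b - x \<bullet> b)) = (0::real)"
      by (intro prod_zero bexI[OF _ b(1)]) auto
    with False show ?thesis by simp
  qed
  finally show ?thesis .
qed

lemma tcd_prod:
  fixes f :: "'i \<Rightarrow> 'a::real_normed_vector \<Rightarrow> real"
  shows "(\<And>i. i \<in> I \<Longrightarrow> tcd m (f i)) \<Longrightarrow> tcd m (\<lambda>x. \<Prod>i\<in>I. f i x)"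
  by (induction I rule: infinite_finite_induct) (auto intro!: tcd_const tcd_mult)

lemma tcd_box_bump: "tcd m (box_bump a c j)"
proof -
  have "tcd m (\<lambda>x. r * (x \<bullet> b - s))" "tcd m (\<lambda>x. r * (s - x \<bullet> b))" for r s :: real and b :: 'a
  proof -
    have "tcd m (\<lambda>x. r * (x \<bullet> b + (- s)))" "tcd m (\<lambda>x. r * (s + (- 1) * (x \<bullet> b)))"
      by (intro tcd_mult tcd_add tcd_const tcd_inner_right)+
    then show "tcd m (\<lambda>x. r * (x \<bullet> b - s))" "tcd m (\<lambda>x. r * (s - x \<bullet> b))" by simp_all
  qed
  then show ?thesis
    unfolding box_bump_def
    by (intro tcd_prod tcd_mult[of m "\<lambda>x. flat_exp 1 (_ x)"] tcd_flat_exp) assumption+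
qed

lemma test_function_box_bump:
  assumes "cbox a c \<subseteq> \<Omega>"
  shows "test_function \<Omega> (box_bump a c j)"
proof -
  have "{x. box_bump a c j x \<noteq> 0} \<subseteq> cbox a c"
    using box_bump_eq_0 box_subset_cbox by blast
  then have "closure {x. box_bump a c j x \<noteq> 0} \<subseteq> cbox a c"
    by (simp add: closure_minimal closed_cbox)
  then show ?thesis
    using assms compact_cbox compact_closure bounded_subset[OF bounded_cbox]
    unfolding test_function_def smooth_on_def
    by (metis closure_subset dual_order.trans tcd_box_bump)
qed

subsection \<open>Weak gradients\<close>

lemma lebesgue_on_integral_eq_subset:
  fixes f :: "'a::euclidean_space \<Rightarrow> real"
  assumes "S \<in> sets lebesgue" "K \<in> sets lebesgue" "K \<subseteq> S" "\<And>x. x \<in> S - K \<Longrightarrow> f x = 0"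
  shows "(LINT x|lebesgue_on S. f x) = (LINT x|lebesgue_on K. f x)"
proof -
  have "(LINT x|lebesgue_on S. f x) = (LINT x|lebesgue. (if x \<in> S then f x else 0))"
    by (rule Lebesgue_Measure.integral_restrict_UNIV[OF assms(1), of f, symmetric])
  also have "(\<lambda>x. if x \<in> S then f x else 0) = (\<lambda>x. if x \<in> K then f x else 0)"
    using assms(3,4) by (auto simp: fun_eq_iff)
  also have "(LINT x|lebesgue. (if x \<in> K then f x else 0)) = (LINT x|lebesgue_on K. f x)"
    by (rule Lebesgue_Measure.integral_restrict_UNIV[OF assms(2), of f])
  finally show ?thesis .
qed

text \<open>Open boxes form an intersection-stable generator of the Borel sets, and the vanishing
  total integral gives closure under complements, so the pi-lambda argument applies to the signed
  density \<open>W\<close>.\<close>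

lemma AE_0_if_box_integrals_0:
  fixes W :: "'a::euclidean_space \<Rightarrow> real"
  assumes W: "integrable lebesgue W"
    and box: "\<And>p q. (LINT x:box p q|lebesgue. W x) = 0"
    and total: "(LINT x|lebesgue. W x) = 0"
  shows "AE x in lebesgue. W x = 0"
proof -
  have setint: "set_integrable lebesgue A W" if "A \<in> sets lebesgue" for A
    using W that unfolding set_integrable_def by (rule integrable_mult_indicator[rotated])
  have leb: "A \<in> sets lebesgue" if "A \<in> sets borel" for A :: "'a set"
    using that by (simp add: sets_completionI_sets)
  have borel: "(LINT x:A|lebesgue. W x) = 0" if "A \<in> sets borel" for A
  proof -
    have "Int_stable (range (\<lambda>(a, b). box a b :: 'a set))"
      by (auto simp: Int_stable_def box_Int_box)
    moreover have "range (\<lambda>(a, b). box a b :: 'a set) \<subseteq> Pow UNIV" by auto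
    moreover have "A \<in> sigma_sets UNIV (range (\<lambda>(a, b). box a b))"
      using that unfolding borel_eq_box by simp
    ultimately show ?thesis
    proof (induction rule: sigma_sets_induct_disjoint)
      case (basic A)
      then show ?case using box by auto
    next
      case empty
      then show ?case by (simp add: set_lebesgue_integral_def)
    next
      case (compl A)
      then have A: "A \<in> sets borel" unfolding borel_eq_box by simp
      have "(LINT x:UNIV|lebesgue. W x) = (LINT x:A|lebesgue. W x) + (LINT x:UNIV - A|lebesgue. W x)"
        using set_integral_Un[of A "UNIV - A" lebesgue W, OF _ setint setint] leb[OF A] leb[of "UNIV - A"] A
        by (simp add: Un_Diff_cancel)
      moreover have "(LINT x:UNIV|lebesgue. W x) = 0"
        using total by (simp add: set_lebesgue_integral_def)
      ultimately show ?case using compl by simp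
    next
      case (union A)
      then have A: "A i \<in> sets borel" for i
        unfolding borel_eq_box by (simp add: image_subset_iff)
      have "(LINT x:(\<Union>i. A i)|lebesgue. W x) = suminf (\<lambda>i. LINT x:A i|lebesgue. W x)"
      proof (rule lebesgue_integral_countable_add)
        show "A i \<in> sets lebesgue" for i by (rule leb[OF A])
        show "A i \<inter> A j = {}" if "i \<noteq> j" for i j
          using union(1) that by (simp add: disjoint_family_on_def)
        have "(\<Union>i. A i) \<in> sets borel" using A by blast
        then show "set_integrable lebesgue (\<Union>i. A i) W"
          by (rule setint[OF leb])
      qed
      then show ?case using union by simp
    qed
  qed
  show ?thesis
  proof (rule density_unique_real[OF W, of "\<lambda>x. 0"])
    \<comment> \<open>A Lebesgue set is a Borel set up to a null set, which does not affect the
      integral.\<close>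
    fix A :: "'a set" assume "A \<in> sets lebesgue"
    then have "A \<in> {S \<union> N | S N N'. S \<in> sets lborel \<and> N' \<in> null_sets lborel \<and> N \<subseteq> N'}"
      by (simp only: sets_completion)
    then obtain S N N' where A: "A = S \<union> N" "N \<subseteq> N'" "N' \<in> null_sets lborel" "S \<in> sets lborel"
      by blast
    then have N: "N \<in> null_sets lebesgue"
      by (intro null_sets_completion_subset[OF A(2)] null_sets_completionI A(3))
    have "AE x in lebesgue. x \<in> A \<longleftrightarrow> x \<in> S"
      using AE_not_in[OF N] by eventually_elim (auto simp: A(1))
    then have "(LINT x:A|lebesgue. W x) = (LINT x:S|lebesgue. W x)"
    proof (rule set_integral_cong_set[symmetric, rotated 2])
      show "set_borel_measurable lebesgue A W" "set_borel_measurable lebesgue S W"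
        using setint[of A] setint[of S] leb[of S] A(4) \<open>A \<in> sets lebesgue\<close>
        by (auto simp: set_integrable_def set_borel_measurable_def dest: borel_measurable_integrable)
    qed
    with borel A(4) show "(LINT x:A|lebesgue. W x) = (LINT x:A|lebesgue. 0)"
      by (simp add: set_lebesgue_integral_def)
  qed simp
qed

text \<open>Testing with box bumps and passing to the limit shows that each component of
  \<open>g - h\<close> has integral zero over every small box, hence vanishes almost everywhere
  there. Countably many boxes exhaust the domain.\<close>

lemma weak_gradient_unique:
  assumes "open \<Omega>" "has_weak_gradient \<Omega> u g" "has_weak_gradient \<Omega> u h"
  shows "AE x in lebesgue_on \<Omega>. g x = h x"
proof -
  have \<Omega>: "\<Omega> \<in> sets lebesgue" using assms(1) by simp
  have box: "AE x in lebesgue. x \<in> box a c \<longrightarrow> (g x - h x) \<bullet> i = 0"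
    if sub: "cbox a c \<subseteq> \<Omega>" and i: "i \<in> Basis" for a c i
  proof -
    let ?K = "cbox a c"
    let ?M = "lebesgue_on ?K"
    define w where "w x = (g x - h x) \<bullet> i" for x
    have int: "integrable ?M g" "integrable ?M h"
      using assms(2,3) sub by (auto simp: has_weak_gradient_def)
    then have gi: "integrable ?M (\<lambda>x. g x \<bullet> i)" "integrable ?M (\<lambda>x. h x \<bullet> i)" by auto
    then have wint: "integrable ?M w" unfolding w_def by (simp add: inner_diff_left)
    have ind_meas: "(\<lambda>x. indicator (box p q) x :: real) \<in> borel_measurable ?M" for p q
      by (intro measurable_restrict_space1 borel_measurable_indicator) simp
    have bump0: "(LINT x|?M. w x * box_bump p q j x) = 0" if "cbox p q \<subseteq> ?K" for p q j
    proof -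
      let ?\<phi> = "box_bump p q j"
      have \<phi>0: "?\<phi> x = 0" if "x \<in> \<Omega> - ?K" for x
        using that \<open>cbox p q \<subseteq> ?K\<close> box_subset_cbox[of p q] by (intro box_bump_eq_0) auto
      have cont: "continuous_on UNIV ?\<phi>"
        using tcd_box_bump[of 0] by simp
      have meas: "?\<phi> \<in> borel_measurable ?M"
        by (rule continuous_imp_measurable_on_sets_lebesgue) (auto intro: continuous_on_subset cont)
      have prod_int: "integrable ?M (\<lambda>x. f x * ?\<phi> x)" if f: "integrable ?M f" for f :: "'a \<Rightarrow> real"
      proof (rule Bochner_Integration.integrable_bound[OF f])
        show "(\<lambda>x. f x * ?\<phi> x) \<in> borel_measurable ?M"
          using f meas by auto
        show "AE x in ?M. norm (f x * ?\<phi> x) \<le> norm (f x)"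
          by (intro AE_I2) (simp add: abs_mult box_bump_bounds mult_left_le)
      qed
      have "test_function \<Omega> ?\<phi>"
        using that sub by (intro test_function_box_bump) auto
      then have "(LINT x|lebesgue_on \<Omega>. u x * frechet_derivative ?\<phi> (at x) i) =
            - (LINT x|lebesgue_on \<Omega>. (f x \<bullet> i) * ?\<phi> x)" if "has_weak_gradient \<Omega> u f" for f
        using that i by (simp add: has_weak_gradient_def)
      from this[OF assms(2)] this[OF assms(3)]
      have "(LINT x|lebesgue_on \<Omega>. (g x \<bullet> i) * ?\<phi> x) = (LINT x|lebesgue_on \<Omega>. (h x \<bullet> i) * ?\<phi> x)"
        by linarith
      \<comment> \<open>The bump vanishes outside \<open>?K\<close>, which moves the integral to a
        compact set, where weak gradients are integrable.\<close>
      moreover have "(LINT x|lebesgue_on \<Omega>. f x * ?\<phi> x) = (LINT x|?M. f x * ?\<phi> x)" for f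
        by (rule lebesgue_on_integral_eq_subset) (use \<Omega> sub \<phi>0 in auto)
      ultimately have "(LINT x|?M. (g x \<bullet> i) * ?\<phi> x) = (LINT x|?M. (h x \<bullet> i) * ?\<phi> x)" by simp
      then show ?thesis
        using prod_int[OF gi(1)] prod_int[OF gi(2)]
        by (simp add: w_def inner_diff_left left_diff_distrib)
    qed
    have ind0: "(LINT x|?M. w x * indicator (box p q) x) = 0" if "box p q \<subseteq> box a c" for p q
    proof (cases "box p q = {}")
      case True
      then show ?thesis by simp
    next
      case False
      then have sub': "cbox p q \<subseteq> ?K"
        using that by (auto simp: subset_box box_eq_empty)
      have meas: "box_bump p q j \<in> borel_measurable ?M" for j
        using tcd_box_bump[of 0]
        by (intro continuous_imp_measurable_on_sets_lebesgue) (auto intro: continuous_on_subset)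
      have "(\<lambda>j. LINT x|?M. w x * box_bump p q j x) \<longlonglongrightarrow> (LINT x|?M. w x * indicator (box p q) x)"
      proof (rule integral_dominated_convergence[where w = "\<lambda>x. norm (w x)"])
        show "(\<lambda>x. w x * indicator (box p q) x) \<in> borel_measurable ?M"
          by (intro borel_measurable_times borel_measurable_integrable wint ind_meas)
        show "(\<lambda>x. w x * box_bump p q j x) \<in> borel_measurable ?M" for j
          by (intro borel_measurable_times borel_measurable_integrable wint meas)
        show "integrable ?M (\<lambda>x. norm (w x))" using wint by simp
        show "AE x in ?M. (\<lambda>j. w x * box_bump p q j x) \<longlonglongrightarrow> w x * indicator (box p q) x"
          by (intro AE_I2 tendsto_intros box_bump_tendsto)
        show "AE x in ?M. norm (w x * box_bump p q j x) \<le> norm (w x)" for j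
          by (intro AE_I2) (simp add: abs_mult box_bump_bounds mult_left_le)
      qed
      then show ?thesis
        unfolding bump0[OF sub'] by (simp add: LIMSEQ_const_iff)
    qed
    \<comment> \<open>Cutting off to \<open>box a c\<close> reduces the integral over an arbitrary
      box to one over its intersection with \<open>box a c\<close>, which is again a box.\<close>
    define W where "W x = (if x \<in> ?K then w x * indicator (box a c) x else 0)" for x
    have "AE x in lebesgue. W x = 0"
    proof (rule AE_0_if_box_integrals_0)
      have "integrable ?M (\<lambda>x. w x * indicator (box a c) x)"
        by (rule Bochner_Integration.integrable_bound[OF wint])
           (intro borel_measurable_times borel_measurable_integrable wint ind_meas,
            simp add: indicator_def)
      then show "integrable lebesgue W"
        unfolding W_def by (subst Lebesgue_Measure.integrable_restrict_UNIV) auto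
      have eq: "(LINT x|lebesgue. (if x \<in> ?K then w x * indicator (box p q) x else 0)) = 0"
        if "box p q \<subseteq> box a c" for p q
        using ind0[OF that] by (subst Lebesgue_Measure.integral_restrict_UNIV) auto
      show "(LINT x|lebesgue. W x) = 0"
        unfolding W_def by (rule eq) simp
      fix p q :: 'a
      obtain p' q' where pq: "box p q \<inter> box a c = box p' q'"
        using box_Int_box by blast
      have "indicator (box p q) x *\<^sub>R W x = (if x \<in> ?K then w x * indicator (box p' q') x else 0)" for x
        unfolding W_def pq[symmetric] by (auto simp: indicator_def)
      then show "(LINT x:box p q|lebesgue. W x) = 0"
        unfolding set_lebesgue_integral_def using eq[of p' q'] pq[symmetric] by simp
    qed
    then show ?thesis
      by eventually_elim (use box_subset_cbox[of a c] in \<open>auto simp: W_def w_def\<close>)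
  qed
  have cbox: "AE x in lebesgue. x \<in> cbox a c \<longrightarrow> g x = h x" if sub: "cbox a c \<subseteq> \<Omega>" for a c
  proof -
    have "AE x in lebesgue. \<forall>i\<in>Basis. x \<in> box a c \<longrightarrow> (g x - h x) \<bullet> i = 0"
      using box[OF sub] by (intro AE_finite_allI) auto
    \<comment> \<open>The bumps control only the open box; its boundary is a null set.\<close>
    moreover have "AE x in lebesgue. x \<notin> cbox a c - box a c"
      using negligible_frontier_interval by (intro AE_not_in) (simp add: negligible_iff_null_sets)
    ultimately show ?thesis
      by eventually_elim (auto simp: euclidean_eq_iff[of "g _"] inner_diff_left)
  qed
  obtain D where D: "countable D" "D \<subseteq> Pow \<Omega>" "\<And>X. X \<in> D \<Longrightarrow> \<exists>a b. X = cbox a b" "\<Union>D = \<Omega>"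
    using open_countable_Union_open_cbox[OF assms(1)] by blast
  have "AE x in lebesgue. \<forall>X\<in>D. x \<in> X \<longrightarrow> g x = h x"
    unfolding AE_ball_countable[OF D(1)]
  proof
    fix X assume "X \<in> D"
    with D obtain a b where "X = cbox a b" "cbox a b \<subseteq> \<Omega>" by blast
    then show "AE x in lebesgue. x \<in> X \<longrightarrow> g x = h x" using cbox by simp
  qed
  then have "AE x in lebesgue. x \<in> \<Omega> \<longrightarrow> g x = h x"
    by eventually_elim (use D(4) in blast)
  then show ?thesis
    using \<Omega> by (subst AE_restrict_space_iff) auto
qed

section \<open>Weak gradients of C^1 functions\<close>

lemma lborel_integral_translation:
  fixes f :: "'a::euclidean_space \<Rightarrow> real"
  assumes "f \<in> borel_measurable borel"
  shows "(LINT x|lborel. f (c + x)) = (LINT x|lborel. f x)"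
proof -
  have "(LINT x|lborel. f x) = (LINT x|distr lborel borel ((+) c). f x)"
    by (simp only: lborel_distr_plus)
  also have "\<dots> = (LINT x|lborel. f (c + x))"
    by (rule integral_distr) (use assms in auto)
  finally show ?thesis by simp
qed

lemma lborel_integrable_translation:
  fixes f :: "'a::euclidean_space \<Rightarrow> real"
  assumes "integrable lborel f"
  shows "integrable lborel (\<lambda>x. f (c + x))"
proof -
  have "integrable (distr lborel borel ((+) c)) f"
    using assms by (simp only: lborel_distr_plus)
  then show ?thesis
    by (rule integrable_distr[rotated]) simp
qed

lemma integrable_continuous_compact_support:
  fixes f :: "'a::euclidean_space \<Rightarrow> real"
  assumes "continuous_on UNIV f" "compact K" "\<And>x. x \<notin> K \<Longrightarrow> f x = 0"
  shows "integrable lborel f"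
proof -
  have "integrable lborel (\<lambda>x. indicator K x *\<^sub>R f x)"
    by (rule borel_integrable_compact[OF assms(2)]) (use assms(1) continuous_on_subset in blast)
  also have "(\<lambda>x. indicator K x *\<^sub>R f x) = f"
    using assms(3) by (auto simp: indicator_def fun_eq_iff)
  finally show ?thesis .
qed

lemma has_derivative_0_outside_closed:
  assumes "closed K" "\<And>x. x \<notin> K \<Longrightarrow> f x = 0" "x \<notin> K" "(f has_derivative D) (at x)"
  shows "D = (\<lambda>v. 0)"
proof -
  have "(f has_derivative (\<lambda>v. 0)) (at x)"
    by (rule has_derivative_transform_within_open[of "\<lambda>x. 0" _ _ _ "- K"])
       (use assms in \<open>auto simp: open_Compl\<close>)
  then show ?thesis using assms(4) has_derivative_unique by blast
qed

lemma continuous_compact_support_bounded: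
  fixes f :: "'a::euclidean_space \<Rightarrow> real"
  assumes "continuous_on UNIV f" "compact K" "\<And>x. x \<notin> K \<Longrightarrow> f x = 0"
  obtains M where "M \<ge> 0" "\<And>x. \<bar>f x\<bar> \<le> M"
proof -
  have "bounded (f ` K)"
    by (intro compact_imp_bounded compact_continuous_image assms continuous_on_subset[OF assms(1)]) simp
  then obtain M where M: "M > 0" "\<And>x. x \<in> K \<Longrightarrow> \<bar>f x\<bar> \<le> M"
    unfolding bounded_pos by auto
  have "\<bar>f x\<bar> \<le> M" for x using M assms(3)[of x] by (cases "x \<in> K") auto
  with M show ?thesis by (intro that[of M]) auto
qed

text \<open>Difference quotients have integral zero by translation invariance.\<close>

lemma integral_directional_derivative_eq_0:
  fixes f :: "'a::euclidean_space \<Rightarrow> real"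
  assumes der: "\<And>x. (f has_derivative D x) (at x)"
    and cont: "continuous_on UNIV (\<lambda>x. D x b)"
    and K: "compact K" "\<And>x. x \<notin> K \<Longrightarrow> f x = 0"
  shows "(LINT x|lborel. D x b) = 0"
proof -
  have f_cont: "continuous_on UNIV f"
    using der by (meson continuous_at_imp_continuous_on has_derivative_continuous)
  have f_int: "integrable lborel f"
    by (rule integrable_continuous_compact_support[OF f_cont K])
  have D0: "D x b = 0" if "x \<notin> K" for x
    using has_derivative_0_outside_closed[OF compact_imp_closed[OF K(1)] K(2) that der] by simp
  obtain M where M: "M \<ge> 0" "\<And>x. \<bar>D x b\<bar> \<le> M"
    using continuous_compact_support_bounded[OF cont K(1) D0] by blast
  obtain R where R: "\<And>x. x \<in> K \<Longrightarrow> norm x \<le> R"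
    using compact_imp_bounded[OF K(1)] unfolding bounded_iff by blast
  define t where "t j = inverse (real (Suc j))" for j
  have t: "t j > 0" "t j \<le> 1" for j
    by (auto simp: t_def inverse_le_1_iff)
  define h where "h j x = (f (t j *\<^sub>R b + x) - f x) / t j" for j x
  have line: "((\<lambda>s. f (x + s *\<^sub>R b)) has_derivative (\<lambda>d. D (x + s *\<^sub>R b) (d *\<^sub>R b))) (at s)" for x s
    by (rule has_derivative_compose[OF _ der]) (auto intro!: derivative_eq_intros)
  have lineD: "((\<lambda>s. f (x + s *\<^sub>R b)) has_real_derivative D (x + s *\<^sub>R b) b) (at s)" for x s
    unfolding has_field_derivative_def
    using line[of x s] linear_cmul[OF has_derivative_linear[OF der[of "x + s *\<^sub>R b"]], of _ b]
    by (simp add: mult_commute_abs)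
  have h_int: "integrable lborel (h j)" for j
    unfolding h_def
    by (intro integrable_divide Bochner_Integration.integrable_diff f_int lborel_integrable_translation)
  have h0: "(LINT x|lborel. h j x) = 0" for j
    unfolding h_def
    using f_int lborel_integrable_translation[OF f_int]
    by (simp add: lborel_integral_translation)
  have "(\<lambda>j. LINT x|lborel. h j x) \<longlonglongrightarrow> (LINT x|lborel. D x b)"
  \<comment> \<open>By the mean value theorem the difference quotients are bounded by
    \<open>M\<close>; since \<open>t j \<le> 1\<close>, they vanish beyond distance
    \<open>R + norm b\<close> from the origin.\<close>
  proof (rule integral_dominated_convergence[where w = "\<lambda>x. indicator (cball 0 (R + norm b)) x *\<^sub>R M"])
    show "(\<lambda>x. D x b) \<in> borel_measurable lborel"
      using cont by (simp add: borel_measurable_continuous_onI)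
    show "h j \<in> borel_measurable lborel" for j
      using h_int by (rule borel_measurable_integrable)
    show "integrable lborel (\<lambda>x. indicator (cball 0 (R + norm b)) x *\<^sub>R M)"
      by (rule borel_integrable_compact) auto
    show "AE x in lborel. (\<lambda>j. h j x) \<longlonglongrightarrow> D x b"
    proof (rule AE_I2)
      fix x
      have "((\<lambda>s. (f (x + (0 + s) *\<^sub>R b) - f (x + 0 *\<^sub>R b)) / s) \<longlongrightarrow> D x b) (at 0)"
        using lineD[of x 0] unfolding DERIV_def by simp
      moreover have "filterlim t (at 0) sequentially"
        unfolding filterlim_at t_def using LIMSEQ_inverse_real_of_nat by (auto simp: eventually_sequentially)
      ultimately have "(\<lambda>j. (f (x + (0 + t j) *\<^sub>R b) - f (x + 0 *\<^sub>R b)) / t j) \<longlonglongrightarrow> D x b"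
        by (rule filterlim_compose)
      then show "(\<lambda>j. h j x) \<longlonglongrightarrow> D x b"
        by (simp add: h_def add.commute)
    qed
    show "AE x in lborel. norm (h j x) \<le> indicator (cball 0 (R + norm b)) x *\<^sub>R M" for j
    proof (rule AE_I2)
      fix x
      show "norm (h j x) \<le> indicator (cball 0 (R + norm b)) x *\<^sub>R M"
      proof (cases "x \<in> cball 0 (R + norm b)")
        case True
        obtain z where "f (x + t j *\<^sub>R b) - f (x + 0 *\<^sub>R b) = (t j - 0) * D (x + z *\<^sub>R b) b"
          using MVT2[OF t(1)[of j], of "\<lambda>s. f (x + s *\<^sub>R b)" "\<lambda>s. D (x + s *\<^sub>R b) b"] lineD by blast
        then have "h j x = D (x + z *\<^sub>R b) b"
          using t(1)[of j] by (simp add: h_def add.commute)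
        then show ?thesis using M(2) True by simp
      next
        case False
        have "norm (t j *\<^sub>R b) \<le> norm b"
          using t[of j] by (simp add: mult_left_le_one_le)
        moreover have "norm x \<le> norm (t j *\<^sub>R b + x) + norm (t j *\<^sub>R b)"
          by (metis add_diff_cancel_left' norm_triangle_sub norm_minus_commute norm_triangle_ineq4)
        ultimately have "t j *\<^sub>R b + x \<notin> K" "x \<notin> K"
          using False R[of x] R[of "t j *\<^sub>R b + x"] norm_ge_zero[of b] by fastforce+
        then show ?thesis using K(2) False by (simp add: h_def)
      qed
    qed
  qed
  then show ?thesis by (simp add: h0 LIMSEQ_const_iff)
qed

text \<open>Integration by parts: the product of \<open>f\<close> and a test function has compact
  support, so its directional derivative has integral zero, and the product rule splits this
  integral into the two sides.\<close>

lemma has_weak_gradient_C1: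
  fixes f :: "'a::euclidean_space \<Rightarrow> real"
  assumes "open \<Omega>"
    and der: "\<And>x. (f has_derivative (\<lambda>v. G x \<bullet> v)) (at x)"
    and G: "continuous_on UNIV G"
  shows "has_weak_gradient \<Omega> f G"
  unfolding has_weak_gradient_def
proof (intro conjI allI impI ballI)
  have f: "continuous_on UNIV f"
    using der by (meson continuous_at_imp_continuous_on has_derivative_continuous)
  have int: "integrable (lebesgue_on K) g" if "continuous_on UNIV g" "compact K"
    for K and g :: "'a \<Rightarrow> 'b::euclidean_space"
  proof -
    have "integrable lborel (\<lambda>x. indicator K x *\<^sub>R g x)"
      by (rule borel_integrable_compact[OF that(2)]) (use that(1) continuous_on_subset in blast)
    then have "integrable lebesgue (\<lambda>x. indicator K x *\<^sub>R g x)"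
      by (simp add: integrable_completion)
    then show ?thesis
      using lmeasurable_compact[OF that(2)] by (subst integrable_restrict_space) (auto dest: fmeasurableD)
  qed
  fix K assume "compact K \<and> K \<subseteq> \<Omega>"
  then show "integrable (lebesgue_on K) f" "integrable (lebesgue_on K) G"
    using int f G by blast+
next
  have f: "continuous_on UNIV f"
    using der by (meson continuous_at_imp_continuous_on has_derivative_continuous)
  fix \<phi> and b :: 'a assume "test_function \<Omega> \<phi>" and "b \<in> Basis"
  define K where "K = closure {x. \<phi> x \<noteq> 0}"
  have K: "compact K" "K \<subseteq> \<Omega>" and C: "tcd m \<phi>" for m
    using \<open>test_function \<Omega> \<phi>\<close> by (auto simp: test_function_def smooth_on_def K_def)
  have \<phi>0: "\<phi> x = 0" if "x \<notin> K" for x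
    using that closure_subset[of "{x. \<phi> x \<noteq> 0}"] by (auto simp: K_def)
  let ?D = "\<lambda>x. frechet_derivative \<phi> (at x)"
  have \<phi>: "(\<phi> has_derivative ?D x) (at x)" for x
    by (rule tcd_Suc_has_derivative(1)[OF C])
  have D0: "?D x b = 0" if "x \<notin> K" for x
    using has_derivative_0_outside_closed[OF compact_imp_closed[OF K(1)] \<phi>0 that \<phi>] by simp
  have cont: "continuous_on UNIV \<phi>" "continuous_on UNIV (\<lambda>x. ?D x b)"
    using C[of 0] tcd_Suc_has_derivative(2)[OF C[of "Suc 0"], of b] by simp_all
  have cD: "continuous_on UNIV (\<lambda>x. f x * ?D x b)" and cG: "continuous_on UNIV (\<lambda>x. (G x \<bullet> b) * \<phi> x)"
    by (intro continuous_intros f G cont)+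
  have iD: "integrable lborel (\<lambda>x. f x * ?D x b)"
    by (rule integrable_continuous_compact_support[OF cD K(1)]) (simp add: D0)
  have iG: "integrable lborel (\<lambda>x. (G x \<bullet> b) * \<phi> x)"
    by (rule integrable_continuous_compact_support[OF cG K(1)]) (simp add: \<phi>0)
  have "(LINT x|lborel. f x * ?D x b + (G x \<bullet> b) * \<phi> x) = 0"
    by (rule integral_directional_derivative_eq_0[where f = "\<lambda>x. f x * \<phi> x" and K = K
          and D = "\<lambda>x v. f x * ?D x v + (G x \<bullet> v) * \<phi> x"])
       (auto intro!: has_derivative_mult der \<phi> continuous_on_add cD cG K simp: \<phi>0)
  then have eq: "(LINT x|lborel. f x * ?D x b) = - (LINT x|lborel. (G x \<bullet> b) * \<phi> x)"
    using iD iG by simp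
  \<comment> \<open>The integrands are supported in \<open>K\<close>, inside the domain, so they
    have the same integral over the whole space.\<close>
  have leb: "(LINT x|lebesgue_on \<Omega>. g x) = (LINT x|lborel. g x)"
    if "continuous_on UNIV g" "\<And>x. x \<notin> K \<Longrightarrow> g x = 0" for g :: "'a \<Rightarrow> real"
  proof -
    have "(LINT x|lebesgue_on UNIV. g x) = (LINT x|lebesgue_on \<Omega>. g x)"
      by (rule lebesgue_on_integral_eq_subset) (use assms(1) K that(2) in auto)
    moreover have "(LINT x|lebesgue. g x) = (LINT x|lborel. g x)"
      by (rule integral_completion) (use that(1) in \<open>simp add: borel_measurable_continuous_onI\<close>)
    ultimately show ?thesis by (simp add: lebesgue_on_UNIV_eq)
  qed
  show "(LINT x|lebesgue_on \<Omega>. f x * ?D x b) = - (LINT x|lebesgue_on \<Omega>. (G x \<bullet> b) * \<phi> x)"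
    using leb[OF cD] leb[OF cG] eq D0 \<phi>0 by simp
qed

subsection \<open>Disjoint balls with a doubling property\<close>

lemma measure_lborel_ball:
  fixes c :: "'a::euclidean_space"
  assumes "r \<ge> 0"
  shows "measure lborel (ball c r) = r ^ DIM('a) * measure lborel (ball (0 :: 'a) 1)"
  using content_ball_conv_unit_ball[OF assms, of c] by simp

text \<open>By Fubini, the averages over \<open>c \<in> S\<close> of the volumes of \<open>\<Omega> \<inter> ball c (r / 2)\<close> and
  \<open>\<Omega> \<inter> ball c r\<close> are comparable, because \<open>S\<close> contains most of the balls of radius \<open>r / 2\<close>
  centred in \<open>\<Omega>\<close>.\<close>

lemma doubling_center:
  fixes \<Omega> S T :: "'a::euclidean_space set"
  assumes \<Omega>: "\<Omega> \<in> sets borel" "emeasure lborel \<Omega> < \<infinity>" and S: "S \<in> sets borel" and T: "T \<in> sets borel"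
    and "r > 0" and sub: "T \<subseteq> \<Omega>" "\<And>x. x \<in> T \<Longrightarrow> ball x (r / 2) \<subseteq> S"
    and large: "measure lborel \<Omega> \<le> 2 * measure lborel T" "measure lborel T > 0"
  shows "\<exists>c\<in>S. measure lborel (\<Omega> \<inter> ball c (r / 2)) > 0 \<and>
    measure lborel (\<Omega> \<inter> ball c r) \<le> 2 ^ (DIM('a) + 2) * measure lborel (\<Omega> \<inter> ball c (r / 2))"
proof (rule ccontr)
  assume contra: "\<not> ?thesis"
  \<comment> \<open>The power \<open>2 ^ DIM('a)\<close> compensates for halving the radius; the
    remaining factor 4 exceeds the factor 2 in the volume hypothesis, which gives the
    contradiction.\<close>
  let ?N = "2 ^ (DIM('a) + 2) :: real"
  have fin: "emeasure lborel (\<Omega> \<inter> A) < \<infinity>" for A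
    using emeasure_mono[of "\<Omega> \<inter> A" \<Omega> lborel] \<Omega> by (auto simp: order.strict_trans1)
  have em: "emeasure lborel (\<Omega> \<inter> A) = ennreal (measure lborel (\<Omega> \<inter> A))" for A
    using fin[of A] by (intro emeasure_eq_ennreal_measure) auto
  have ball: "emeasure lborel (ball x \<rho>) = ennreal (\<rho> ^ DIM('a) * measure lborel (ball (0 :: 'a) 1))"
    if "\<rho> > 0" for x :: 'a and \<rho>
    using that measure_lborel_ball[of \<rho> x] emeasure_lborel_ball_finite[of x \<rho>]
    by (subst emeasure_eq_ennreal_measure) auto
  \<comment> \<open>Pairs of a centre in \<open>S\<close> and a point of \<open>\<Omega>\<close>
    closer than \<open>\<rho>\<close>. Slicing at the centre yields the volumes to be averaged,
    slicing at the point yields volumes of balls cut with \<open>S\<close>.\<close>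
  define X where "X \<rho> = {q \<in> space (lborel \<Otimes>\<^sub>M lborel). fst q \<in> S \<and> snd q \<in> \<Omega> \<and> dist (fst q) (snd q) < \<rho>}"
    for \<rho> :: real
  note [measurable] = \<Omega>(1) S T
  have X: "X \<rho> \<in> sets (lborel \<Otimes>\<^sub>M lborel)" for \<rho>
    unfolding X_def by measurable
  have X1: "emeasure (lborel \<Otimes>\<^sub>M lborel) (X \<rho>) = (\<integral>\<^sup>+c. indicator S c * emeasure lborel (\<Omega> \<inter> ball c \<rho>) \<partial>lborel)" for \<rho>
  proof -
    have "Pair c -` X \<rho> = (if c \<in> S then \<Omega> \<inter> ball c \<rho> else {})" for c
      by (auto simp: X_def space_pair_measure)
    then show ?thesis
      unfolding lborel.emeasure_pair_measure_alt[OF X] by (intro nn_integral_cong) auto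
  qed
  have X2: "emeasure (lborel \<Otimes>\<^sub>M lborel) (X \<rho>) = (\<integral>\<^sup>+x. indicator \<Omega> x * emeasure lborel (S \<inter> ball x \<rho>) \<partial>lborel)" for \<rho>
  proof -
    have "(\<lambda>c. (c, x)) -` X \<rho> = (if x \<in> \<Omega> then S \<inter> ball x \<rho> else {})" for x
      by (auto simp: X_def space_pair_measure dist_commute)
    then show ?thesis
      unfolding lborel_pair.emeasure_pair_measure_alt2[OF X] by (intro nn_integral_cong) auto
  qed
  \<comment> \<open>If the claim fails at \<open>c\<close>, either the small volume is zero or the
    doubling estimate fails; both give this reversed inequality.\<close>
  have dbl: "ennreal ?N * emeasure lborel (\<Omega> \<inter> ball c (r / 2)) \<le> emeasure lborel (\<Omega> \<inter> ball c r)" if "c \<in> S" for c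
  proof -
    have "?N * measure lborel (\<Omega> \<inter> ball c (r / 2)) \<le> measure lborel (\<Omega> \<inter> ball c r)"
      using contra that measure_nonneg[of lborel "\<Omega> \<inter> ball c (r / 2)"] measure_nonneg[of lborel "\<Omega> \<inter> ball c r"]
      by (cases "measure lborel (\<Omega> \<inter> ball c (r / 2)) = 0") (auto simp: not_le less_le)
    then show ?thesis unfolding em by (simp flip: ennreal_mult)
  qed
  have meas: "(\<lambda>c. indicator S c * emeasure lborel (\<Omega> \<inter> ball c \<rho>)) \<in> borel_measurable lborel" for \<rho>
  proof -
    have "(\<lambda>c. emeasure lborel (Pair c -` X \<rho>)) \<in> borel_measurable lborel"
      by (rule lborel.measurable_emeasure_Pair[OF X])
    also have "(\<lambda>c. emeasure lborel (Pair c -` X \<rho>)) = (\<lambda>c. indicator S c * emeasure lborel (\<Omega> \<inter> ball c \<rho>))"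
    proof
      fix c
      have "Pair c -` X \<rho> = (if c \<in> S then \<Omega> \<inter> ball c \<rho> else {})"
        by (auto simp: X_def space_pair_measure)
      then show "emeasure lborel (Pair c -` X \<rho>) = indicator S c * emeasure lborel (\<Omega> \<inter> ball c \<rho>)" by auto
    qed
    finally show ?thesis .
  qed
  let ?V = "\<lambda>\<rho>. \<rho> ^ DIM('a) * measure lborel (ball (0 :: 'a) 1)"
  \<comment> \<open>For points of \<open>T\<close> the whole ball of radius \<open>r / 2\<close>
    lies in \<open>S\<close>, which bounds \<open>X (r / 2)\<close> from below; full balls around
    all points of \<open>\<Omega>\<close> bound \<open>X r\<close> from above.\<close>
  have "ennreal (?N * (?V (r / 2) * measure lborel T)) = ennreal ?N * (\<integral>\<^sup>+x. ennreal (?V (r / 2)) * indicator T x \<partial>lborel)"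
  proof -
    have "emeasure lborel T = ennreal (measure lborel T)" using em[of T] sub(1) by (simp add: Int_absorb1)
    then show ?thesis
      using T \<open>r > 0\<close> by (simp add: nn_integral_cmult_indicator ennreal_mult)
  qed
  also have "\<dots> \<le> ennreal ?N * emeasure (lborel \<Otimes>\<^sub>M lborel) (X (r / 2))"
    unfolding X2
  proof (intro mult_left_mono nn_integral_mono)
    fix x
    show "ennreal (?V (r / 2)) * indicator T x \<le> indicator \<Omega> x * emeasure lborel (S \<inter> ball x (r / 2))"
      using sub ball[of "r / 2" x] \<open>r > 0\<close> by (cases "x \<in> T") (auto simp: Int_absorb1)
  qed simp
  also have "\<dots> \<le> emeasure (lborel \<Otimes>\<^sub>M lborel) (X r)"
    unfolding X1
    by (subst nn_integral_cmult[symmetric, OF meas], intro nn_integral_mono)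
       (use dbl in \<open>auto simp: indicator_def\<close>)
  also have "\<dots> \<le> (\<integral>\<^sup>+x. ennreal (?V r) * indicator \<Omega> x \<partial>lborel)"
    unfolding X2
  proof (rule nn_integral_mono)
    fix x
    have "emeasure lborel (S \<inter> ball x r) \<le> emeasure lborel (ball x r)"
      by (rule emeasure_mono) auto
    then show "indicator \<Omega> x * emeasure lborel (S \<inter> ball x r) \<le> ennreal (?V r) * indicator \<Omega> x"
      using ball[of r x] \<open>r > 0\<close> by (auto simp: indicator_def)
  qed
  also have "\<dots> = ennreal (?V r * measure lborel \<Omega>)"
    using \<Omega> em[of \<Omega>] \<open>r > 0\<close> by (simp add: nn_integral_cmult_indicator ennreal_mult)
  finally have "?N * (?V (r / 2) * measure lborel T) \<le> ?V r * measure lborel \<Omega>"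
    using \<open>r > 0\<close> by (subst (asm) ennreal_le_iff) auto
  also have "\<dots> \<le> ?V r * (2 * measure lborel T)"
    using \<open>r > 0\<close> large(1) by (intro mult_left_mono) auto
  also have "\<dots> = 2 ^ DIM('a) * (2 * (?V (r / 2) * measure lborel T))"
    by (simp add: power_divide)
  finally have "2 ^ DIM('a) * (?V (r / 2) * measure lborel T) \<le> 0"
    unfolding power_add by (simp only: power2_eq_square)
  moreover have "?V (r / 2) * measure lborel T > 0"
    using \<open>r > 0\<close> large(2) content_ball_pos[of 1 "0::'a"] by simp
  then have "2 ^ DIM('a) * (?V (r / 2) * measure lborel T) > 0"
    by (rule mult_pos_pos[rotated]) simp
  ultimately show False by linarith
qed

text \<open>Greedy choice: the balls of radius \<open>3 * r\<close> around the centres chosen so far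
  cover at most half of \<open>\<Omega>\<close>. A point outside them has its ball of radius
  \<open>r / 2\<close> at distance at least \<open>2 * r\<close> from these centres, so
  \<open>doubling_center\<close> supplies the next one, with
  \<open>T = \<Omega> - U\<close>.\<close>

lemma separated_doubling_centers:
  fixes \<Omega> :: "'a::euclidean_space set"
  assumes \<Omega>: "\<Omega> \<in> sets borel" "emeasure lborel \<Omega> < \<infinity>" "measure lborel \<Omega> > 0" and "r > 0"
    and vol: "2 * real k * measure lborel (ball (0 :: 'a) (3 * r)) \<le> measure lborel \<Omega>"
  obtains c :: "nat \<Rightarrow> 'a" where
    "\<And>i. i < k \<Longrightarrow> measure lborel (\<Omega> \<inter> ball (c i) (r / 2)) > 0"
    "\<And>i. i < k \<Longrightarrow> measure lborel (\<Omega> \<inter> ball (c i) r) \<le>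
       2 ^ (DIM('a) + 2) * measure lborel (\<Omega> \<inter> ball (c i) (r / 2))"
    "\<And>i j. i < k \<Longrightarrow> j < k \<Longrightarrow> i \<noteq> j \<Longrightarrow> dist (c i) (c j) \<ge> 2 * r"
proof -
  let ?good = "\<lambda>c. measure lborel (\<Omega> \<inter> ball c (r / 2)) > 0 \<and> measure lborel (\<Omega> \<inter> ball c r) \<le>
       2 ^ (DIM('a) + 2) * measure lborel (\<Omega> \<inter> ball c (r / 2))"
  have "\<exists>c :: nat \<Rightarrow> 'a. (\<forall>i<m. ?good (c i)) \<and> (\<forall>i<m. \<forall>j<m. i \<noteq> j \<longrightarrow> dist (c i) (c j) \<ge> 2 * r)"
    if "m \<le> k" for m
    using that
  proof (induction m)
    case (Suc m)
    then obtain c :: "nat \<Rightarrow> 'a" where c: "\<And>i. i < m \<Longrightarrow> ?good (c i)"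
      "\<And>i j. i < m \<Longrightarrow> j < m \<Longrightarrow> i \<noteq> j \<Longrightarrow> dist (c i) (c j) \<ge> 2 * r"
      by auto
    define U where "U = (\<Union>i<m. ball (c i) (3 * r))"
    define S where "S = - (\<Union>i<m. ball (c i) (2 * r))"
    have U: "U \<in> sets borel" unfolding U_def by auto
    have fin: "emeasure lborel U < \<infinity>"
      unfolding U_def by (intro emeasure_bounded_finite bounded_UN) auto
    have "measure lborel U \<le> (\<Sum>i<m. measure lborel (ball (c i) (3 * r)))"
      unfolding U_def by (intro measure_UNION_le) auto
    also have "\<dots> = real m * measure lborel (ball (0 :: 'a) (3 * r))"
      using \<open>r > 0\<close> measure_lborel_ball[of "3 * r" "c _"] measure_lborel_ball[of "3 * r" "0 :: 'a"] by simp
    also have "\<dots> \<le> real k * measure lborel (ball (0 :: 'a) (3 * r))"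
      using Suc.prems by (intro mult_right_mono) auto
    finally have U_le: "2 * measure lborel U \<le> measure lborel \<Omega>"
      using vol by simp
    have "measure lborel \<Omega> \<le> measure lborel (\<Omega> - U) + measure lborel U"
    proof -
      have "measure lborel \<Omega> \<le> measure lborel ((\<Omega> - U) \<union> U)"
        using \<Omega> U fin
        by (intro measure_mono_fmeasurable fmeasurable.Un fmeasurable.Diff) (auto simp: fmeasurable_def)
      also have "\<dots> \<le> measure lborel (\<Omega> - U) + measure lborel U"
        using \<Omega> U by (intro measure_Un_le) auto
      finally show ?thesis .
    qed
    then have large: "measure lborel \<Omega> \<le> 2 * measure lborel (\<Omega> - U)" "measure lborel (\<Omega> - U) > 0"
      using U_le \<Omega>(3) by auto
    have "\<exists>x\<in>S. ?good x"
    proof (rule doubling_center[OF \<Omega>(1,2) _ _ \<open>r > 0\<close> _ _ large])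
      show "S \<in> sets borel" unfolding S_def by (intro borel_closed closed_Compl open_UN) auto
      show "\<Omega> - U \<in> sets borel" using \<Omega> U by auto
      show "ball x (r / 2) \<subseteq> S" if "x \<in> \<Omega> - U" for x
      proof
        fix y assume y: "y \<in> ball x (r / 2)"
        have "dist (c i) y \<ge> 2 * r" if "i < m" for i
        proof -
          have "dist (c i) x \<ge> 3 * r" using \<open>x \<in> \<Omega> - U\<close> \<open>i < m\<close> by (auto simp: U_def not_less)
          moreover have "dist (c i) x \<le> dist (c i) y + dist x y" by (metis dist_commute dist_triangle)
          ultimately show ?thesis using y \<open>r > 0\<close> by simp
        qed
        then show "y \<in> S" by (auto simp: S_def not_less)
      qed
    qed auto
    then obtain x where x: "x \<in> S" "?good x" by blast
    have "dist (c i) x \<ge> 2 * r" if "i < m" for i using x(1) that by (auto simp: S_def not_less)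
    then have "(\<forall>i<Suc m. ?good ((c(m := x)) i)) \<and>
        (\<forall>i<Suc m. \<forall>j<Suc m. i \<noteq> j \<longrightarrow> dist ((c(m := x)) i) ((c(m := x)) j) \<ge> 2 * r)"
      using c x(2) by (auto simp: less_Suc_eq dist_commute)
    then show ?case by blast
  qed auto
  from this[OF order_refl] show ?thesis using that by blast
qed

section \<open>C^1 bumps supported in balls\<close>

text \<open>Squaring the positive part of the quadratic makes it C^1 across the sphere of radius
  \<open>r\<close>.\<close>

definition ball_bump :: "'a::euclidean_space \<Rightarrow> real \<Rightarrow> 'a \<Rightarrow> real" where
  "ball_bump c r x = (max 0 (1 - (x - c) \<bullet> (x - c) / r\<^sup>2))\<^sup>2"

definition ball_bump_gradient :: "'a::euclidean_space \<Rightarrow> real \<Rightarrow> 'a \<Rightarrow> 'a" where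
  "ball_bump_gradient c r x = (2 * max 0 (1 - (x - c) \<bullet> (x - c) / r\<^sup>2)) *\<^sub>R ((- 2 / r\<^sup>2) *\<^sub>R (x - c))"

lemma DERIV_max_0_power2: "((\<lambda>y. (max 0 y)\<^sup>2) has_real_derivative 2 * max 0 y) (at y)"
proof -
  consider "y > 0" | "y < 0" | "y = 0" by linarith
  then show ?thesis
  proof cases
    case 1
    have "((\<lambda>y. y\<^sup>2) has_real_derivative 2 * y) (at y)" by (auto intro!: derivative_eq_intros)
    then have "((\<lambda>y. (max 0 y)\<^sup>2) has_real_derivative 2 * y) (at y)"
      by (rule has_field_derivative_transform_within[where d = y]) (use 1 in \<open>auto simp: dist_real_def\<close>)
    then show ?thesis using 1 by simp
  next
    case 2
    have "((\<lambda>y. 0) has_real_derivative 0) (at y)" by simp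
    then have "((\<lambda>y. (max 0 y)\<^sup>2) has_real_derivative 0) (at y)"
      by (rule has_field_derivative_transform_within[where d = "- y"]) (use 2 in \<open>auto simp: dist_real_def\<close>)
    then show ?thesis using 2 by simp
  next
    case 3
    have "(\<lambda>h. ((max 0 (0 + h))\<^sup>2 - (max 0 0)\<^sup>2) / h) = (\<lambda>h. max 0 (h :: real))"
      by (auto simp: fun_eq_iff max_def power2_eq_square)
    moreover have "((\<lambda>h. max 0 (h :: real)) \<longlongrightarrow> max 0 0) (at 0)" by (intro tendsto_intros)
    ultimately show ?thesis using 3 unfolding DERIV_def by simp
  qed
qed

lemma ball_bump_has_derivative:
  "(ball_bump c r has_derivative (\<lambda>v. ball_bump_gradient c r x \<bullet> v)) (at x)"
proof -
  have "((\<lambda>x. 1 - (x - c) \<bullet> (x - c) / r\<^sup>2) has_derivative (\<lambda>v. - 2 / r\<^sup>2 * ((x - c) \<bullet> v))) (at x)"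
    by (auto intro!: derivative_eq_intros simp: inner_commute divide_inverse algebra_simps)
  from DERIV_compose_FDERIV[OF DERIV_max_0_power2 this] show ?thesis
    unfolding ball_bump_def ball_bump_gradient_def by (simp add: mult_ac)
qed

lemma continuous_ball_bump_gradient: "continuous_on UNIV (ball_bump_gradient c r)"
  unfolding ball_bump_gradient_def divide_inverse by (intro continuous_intros)

lemma ball_bump_outside:
  assumes "r > 0" "x \<notin> ball c r"
  shows "ball_bump c r x = 0" "ball_bump_gradient c r x = 0"
proof -
  have "r\<^sup>2 \<le> (dist x c)\<^sup>2" using assms by (intro power_mono) (auto simp: dist_commute)
  then have "1 - (x - c) \<bullet> (x - c) / r\<^sup>2 \<le> 0"
    using assms(1) by (simp add: dist_norm power2_norm_eq_inner)
  then show "ball_bump c r x = 0" "ball_bump_gradient c r x = 0"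
    by (simp_all add: ball_bump_def ball_bump_gradient_def)
qed

text \<open>The gradient bound is \<open>2 * (2 / r^2) * r\<close>. Within half the radius the
  quadratic is at least \<open>3 / 4\<close>, whose square is \<open>9 / 16\<close>.\<close>

lemma ball_bump_bounds:
  assumes "r > 0"
  shows "0 \<le> ball_bump c r x" "ball_bump c r x \<le> 1" "norm (ball_bump_gradient c r x) \<le> 4 / r"
    "x \<in> ball c (r / 2) \<Longrightarrow> 9 / 16 \<le> ball_bump c r x"
proof -
  let ?q = "1 - (x - c) \<bullet> (x - c) / r\<^sup>2"
  show "0 \<le> ball_bump c r x" by (simp add: ball_bump_def)
  have q: "max 0 ?q \<le> 1" by simp
  then show "ball_bump c r x \<le> 1" unfolding ball_bump_def by (simp add: power_le_one)
  show "norm (ball_bump_gradient c r x) \<le> 4 / r"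
  proof (cases "x \<in> ball c r")
    case True
    have "norm (ball_bump_gradient c r x) = 2 * max 0 ?q * (2 / r\<^sup>2 * norm (x - c))"
      by (simp add: ball_bump_gradient_def abs_mult)
    also have "\<dots> \<le> 2 * 1 * (2 / r\<^sup>2 * r)"
      using q True assms by (intro mult_mono) (auto simp: dist_norm norm_minus_commute)
    also have "\<dots> = 4 / r" using assms by (simp add: power2_eq_square)
    finally show ?thesis .
  qed (use assms in \<open>simp add: ball_bump_outside\<close>)
  show "9 / 16 \<le> ball_bump c r x" if "x \<in> ball c (r / 2)"
  proof -
    have "(dist x c)\<^sup>2 \<le> (r / 2)\<^sup>2" using that by (intro power_mono) (auto simp: dist_commute)
    then have "(x - c) \<bullet> (x - c) \<le> (r / 2)\<^sup>2"
      by (simp add: dist_norm power2_norm_eq_inner)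
    then have "3 / 4 \<le> ?q" using assms by (simp add: field_simps power2_eq_square)
    then have "(3 / 4)\<^sup>2 \<le> (max 0 ?q)\<^sup>2" by (intro power_mono max.coboundedI2) simp_all
    then show ?thesis by (simp add: ball_bump_def power2_eq_square)
  qed
qed

subsection \<open>Linear combinations of functions with disjoint supports\<close>

text \<open>At most one summand is nonzero.\<close>

lemma norm_sum_powr_disjoint:
  fixes z :: "nat \<Rightarrow> 'b::real_normed_vector"
  assumes "\<And>i j. i < k \<Longrightarrow> j < k \<Longrightarrow> i \<noteq> j \<Longrightarrow> z i = 0 \<or> z j = 0"
  shows "norm (\<Sum>i<k. z i) powr p = (\<Sum>i<k. norm (z i) powr p)"
proof (cases "\<exists>i<k. z i \<noteq> 0")
  case True
  then obtain i where i: "i < k" "z i \<noteq> 0" by blast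
  then have z0: "z j = 0" if "j \<in> {..<k} - {i}" for j using assms that by blast
  have "(\<Sum>j<k. z j) = z i" "(\<Sum>j<k. norm (z j) powr p) = norm (z i) powr p"
    using i(1) z0 by (simp_all add: sum.remove[of "{..<k}" i])
  then show ?thesis by simp
qed simp

text \<open>Integrability is known only on compact sets, so measurability is glued from countably
  many closed boxes. This applies in particular to the chosen gradient
  \<open>weak_gradient\<close>.\<close>

lemma weak_gradient_measurable:
  assumes "open \<Omega>" "has_weak_gradient \<Omega> u g"
  shows "g \<in> borel_measurable (lebesgue_on \<Omega>)"
proof -
  obtain D where D: "countable D" "D \<subseteq> Pow \<Omega>" "\<And>X. X \<in> D \<Longrightarrow> \<exists>a b. X = cbox a b" "\<Union>D = \<Omega>"
    using open_countable_Union_open_cbox[OF assms(1)] by blast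
  show ?thesis
  proof (rule measurable_piecewise_restrict[OF D(1)])
    show "space (lebesgue_on \<Omega>) \<subseteq> \<Union>D" using D(4) by simp
    fix X assume X: "X \<in> D"
    then obtain a b where ab: "X = cbox a b" "X \<subseteq> \<Omega>" using D by blast
    have "integrable (lebesgue_on X) g"
      using assms(2) ab by (auto simp: has_weak_gradient_def)
    moreover have "restrict_space (lebesgue_on \<Omega>) X = lebesgue_on X"
      using ab assms(1) by (subst restrict_restrict_space) (auto simp: Int_absorb1)
    ultimately show "g \<in> borel_measurable (restrict_space (lebesgue_on \<Omega>) X)"
      by (simp add: borel_measurable_integrable)
    show "X \<inter> space (lebesgue_on \<Omega>) \<in> sets (lebesgue_on \<Omega>)"
      using ab assms(1) by (auto simp: sets_restrict_space Int_absorb1 intro!: image_eqI[of _ _ X])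
  qed
qed

text \<open>At each point at most one of the functions is active, so the integrals of the
  \<open>p\<close>-th powers are additive over linear combinations and a common bound
  \<open>\<Lambda>\<close> on the individual Rayleigh quotients passes to all of them.\<close>

locale disjoint_family_C1 =
  fixes \<Omega> :: "'a::euclidean_space set" and p :: real and k :: nat and \<Lambda> :: real
    and u :: "nat \<Rightarrow> 'a \<Rightarrow> real" and G :: "nat \<Rightarrow> 'a \<Rightarrow> 'a"
  assumes open_\<Omega>: "open \<Omega>" and p: "p > 1"
    and der: "\<And>i x. i < k \<Longrightarrow> (u i has_derivative (\<lambda>v. G i x \<bullet> v)) (at x)"
    and G_cont: "\<And>i. i < k \<Longrightarrow> continuous_on UNIV (G i)"
    and disjoint: "\<And>i j x. i < k \<Longrightarrow> j < k \<Longrightarrow> i \<noteq> j \<Longrightarrow> (u i x = 0 \<and> G i x = 0) \<or> (u j x = 0 \<and> G j x = 0)"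
    and u_int: "\<And>i. i < k \<Longrightarrow> integrable (lebesgue_on \<Omega>) (\<lambda>x. \<bar>u i x\<bar> powr p)"
    and G_int: "\<And>i. i < k \<Longrightarrow> integrable (lebesgue_on \<Omega>) (\<lambda>x. norm (G i x) powr p)"
    and mass_pos: "\<And>i. i < k \<Longrightarrow> (LINT x|lebesgue_on \<Omega>. \<bar>u i x\<bar> powr p) > 0"
    and energy_le: "\<And>i. i < k \<Longrightarrow> (LINT x|lebesgue_on \<Omega>. norm (G i x) powr p) \<le>
        \<Lambda> * (LINT x|lebesgue_on \<Omega>. \<bar>u i x\<bar> powr p)"
begin

definition mass :: "nat \<Rightarrow> real" where "mass i = (LINT x|lebesgue_on \<Omega>. \<bar>u i x\<bar> powr p)"
definition energy :: "nat \<Rightarrow> real" where "energy i = (LINT x|lebesgue_on \<Omega>. norm (G i x) powr p)"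
definition comb :: "(nat \<Rightarrow> real) \<Rightarrow> 'a \<Rightarrow> real" where "comb a x = (\<Sum>i<k. a i * u i x)"
definition comb_grad :: "(nat \<Rightarrow> real) \<Rightarrow> 'a \<Rightarrow> 'a" where "comb_grad a x = (\<Sum>i<k. a i *\<^sub>R G i x)"

lemma comb_diff: "comb a - comb b = comb (a - b)"
  by (auto simp: comb_def fun_eq_iff sum_subtractf left_diff_distrib)

lemma comb_uminus: "comb (- a) = - comb a"
  by (auto simp: comb_def fun_eq_iff sum_negf)

lemma comb_has_derivative: "(comb a has_derivative (\<lambda>v. comb_grad a x \<bullet> v)) (at x)"
proof -
  have "((\<lambda>x. \<Sum>i<k. a i * u i x) has_derivative (\<lambda>v. \<Sum>i<k. a i * (G i x \<bullet> v))) (at x)"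
    by (intro has_derivative_sum has_derivative_mult_right der) simp
  then show ?thesis
    by (simp add: comb_def[abs_def] comb_grad_def inner_sum_left)
qed

lemma continuous_comb: "continuous_on UNIV (comb a)"
  using comb_has_derivative by (meson continuous_at_imp_continuous_on has_derivative_continuous)

lemma continuous_comb_grad: "continuous_on UNIV (comb_grad a)"
  unfolding comb_grad_def by (intro continuous_intros G_cont) simp

lemma comb_powr: "\<bar>comb a x\<bar> powr p = (\<Sum>i<k. \<bar>a i\<bar> powr p * \<bar>u i x\<bar> powr p)"
proof -
  have "norm (\<Sum>i<k. a i * u i x) powr p = (\<Sum>i<k. norm (a i * u i x) powr p)"
    by (rule norm_sum_powr_disjoint) (use disjoint in fastforce)
  then show ?thesis by (simp add: comb_def abs_mult powr_mult)
qed

lemma comb_grad_powr: "norm (comb_grad a x) powr p = (\<Sum>i<k. \<bar>a i\<bar> powr p * norm (G i x) powr p)"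
proof -
  have "norm (\<Sum>i<k. a i *\<^sub>R G i x) powr p = (\<Sum>i<k. norm (a i *\<^sub>R G i x) powr p)"
    by (rule norm_sum_powr_disjoint) (use disjoint in fastforce)
  then show ?thesis by (simp add: comb_grad_def powr_mult)
qed

lemma comb_integrable: "integrable (lebesgue_on \<Omega>) (\<lambda>x. \<bar>comb a x\<bar> powr p)"
  unfolding comb_powr by (intro Bochner_Integration.integrable_sum integrable_mult_right u_int) simp

lemma comb_grad_integrable: "integrable (lebesgue_on \<Omega>) (\<lambda>x. norm (comb_grad a x) powr p)"
  unfolding comb_grad_powr by (intro Bochner_Integration.integrable_sum integrable_mult_right G_int) simp

lemma comb_integral: "(LINT x|lebesgue_on \<Omega>. \<bar>comb a x\<bar> powr p) = (\<Sum>i<k. \<bar>a i\<bar> powr p * mass i)"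
  unfolding comb_powr mass_def
  by (subst Bochner_Integration.integral_sum) (auto intro: u_int)

lemma comb_grad_integral:
  "(LINT x|lebesgue_on \<Omega>. norm (comb_grad a x) powr p) = (\<Sum>i<k. \<bar>a i\<bar> powr p * energy i)"
  unfolding comb_grad_powr energy_def
  by (subst Bochner_Integration.integral_sum) (auto intro: G_int)

lemma comb_weak_gradient: "has_weak_gradient \<Omega> (comb a) (comb_grad a)"
  by (rule has_weak_gradient_C1[OF open_\<Omega> comb_has_derivative continuous_comb_grad])

lemma meas_comb: "comb a \<in> borel_measurable (lebesgue_on \<Omega>)"
  and meas_comb_grad: "comb_grad a \<in> borel_measurable (lebesgue_on \<Omega>)"
  using open_\<Omega> by (auto intro!: continuous_imp_measurable_on_sets_lebesgue
      intro: continuous_on_subset[OF continuous_comb] continuous_on_subset[OF continuous_comb_grad])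

lemma comb_in_sobolev_space: "comb a \<in> sobolev_space p \<Omega>"
  unfolding sobolev_space_def
  using meas_comb comb_integrable comb_weak_gradient meas_comb_grad comb_grad_integrable by blast

text \<open>\<open>weak_gradient\<close> picks some weak gradient; by uniqueness it agrees with the
  classical one up to a null set.\<close>

lemma weak_gradient_comb_AE: "AE x in lebesgue_on \<Omega>. weak_gradient \<Omega> (comb a) x = comb_grad a x"
  and meas_weak_gradient_comb: "weak_gradient \<Omega> (comb a) \<in> borel_measurable (lebesgue_on \<Omega>)"
proof -
  have "has_weak_gradient \<Omega> (comb a) (weak_gradient \<Omega> (comb a))"
    unfolding weak_gradient_def by (rule someI[of _ "comb_grad a"]) (rule comb_weak_gradient)
  then show "AE x in lebesgue_on \<Omega>. weak_gradient \<Omega> (comb a) x = comb_grad a x"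
    "weak_gradient \<Omega> (comb a) \<in> borel_measurable (lebesgue_on \<Omega>)"
    using weak_gradient_unique[OF open_\<Omega> _ comb_weak_gradient] weak_gradient_measurable[OF open_\<Omega>] by blast+
qed

lemma weak_gradient_comb_integral:
  "(LINT x|lebesgue_on \<Omega>. norm (weak_gradient \<Omega> (comb a) x) powr p) = (\<Sum>i<k. \<bar>a i\<bar> powr p * energy i)"
proof -
  note [measurable] = meas_weak_gradient_comb meas_comb_grad
  have "(LINT x|lebesgue_on \<Omega>. norm (weak_gradient \<Omega> (comb a) x) powr p) =
      (LINT x|lebesgue_on \<Omega>. norm (comb_grad a x) powr p)"
  proof (rule integral_cong_AE)
    show "AE x in lebesgue_on \<Omega>. norm (weak_gradient \<Omega> (comb a) x) powr p = norm (comb_grad a x) powr p"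
      using weak_gradient_comb_AE[of a] by eventually_elim simp
  qed measurable
  then show ?thesis by (simp add: comb_grad_integral)
qed

lemma sobolev_norm_comb:
  "sobolev_norm p \<Omega> (comb a) = (\<Sum>i<k. \<bar>a i\<bar> powr p * (energy i + mass i)) powr (1 / p)"
proof -
  note [measurable] = meas_weak_gradient_comb meas_comb_grad meas_comb
  have "(LINT x|lebesgue_on \<Omega>. norm (weak_gradient \<Omega> (comb a) x) powr p + \<bar>comb a x\<bar> powr p) =
      (LINT x|lebesgue_on \<Omega>. norm (comb_grad a x) powr p + \<bar>comb a x\<bar> powr p)"
  proof (rule integral_cong_AE)
    show "AE x in lebesgue_on \<Omega>. norm (weak_gradient \<Omega> (comb a) x) powr p + \<bar>comb a x\<bar> powr p =
        norm (comb_grad a x) powr p + \<bar>comb a x\<bar> powr p"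
      using weak_gradient_comb_AE[of a] by eventually_elim simp
  qed measurable
  also have "\<dots> = (\<Sum>i<k. \<bar>a i\<bar> powr p * (energy i + mass i))"
    using comb_grad_integrable comb_integrable
    by (simp add: comb_grad_integral comb_integral sum.distrib distrib_left)
  finally show ?thesis unfolding sobolev_norm_def by simp
qed

lemma mass_pos': "i < k \<Longrightarrow> mass i > 0"
  using mass_pos by (simp add: mass_def)

lemma energy_nonneg: "energy i \<ge> 0"
  unfolding energy_def by simp

lemma comb_norm_pos:
  assumes "i < k" "a i \<noteq> 0"
  shows "(\<Sum>i<k. \<bar>a i\<bar> powr p * mass i) > 0"
proof (rule sum_pos2[of _ i])
  show "0 < \<bar>a i\<bar> powr p * mass i" using assms mass_pos' by simp
  show "0 \<le> \<bar>a j\<bar> powr p * mass j" if "j \<in> {..<k}" for j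
    using that mass_pos'[of j] by simp
qed (use assms in auto)

section \<open>The nonzero combinations as an admissible set\<close>

abbreviation coeffs :: "(nat \<Rightarrow> real) set" where
  "coeffs \<equiv> topspace (punctured_space k)"

lemma coeffs_iff: "a \<in> coeffs \<longleftrightarrow> a \<noteq> (\<lambda>i. 0) \<and> (\<forall>i\<ge>k. a i = 0)"
  by (auto simp: topspace_Euclidean_space)

lemma coeffs_nonzero:
  assumes "a \<in> coeffs"
  obtains i where "i < k" "a i \<noteq> 0"
proof -
  obtain i where i: "a i \<noteq> 0" using assms unfolding coeffs_iff by (auto simp: fun_eq_iff)
  moreover have "i < k" using assms i unfolding coeffs_iff by (meson not_less)
  ultimately show ?thesis using that by blast
qed

lemma continuous_map_coordinate:
  "continuous_map (powertop_real UNIV) euclideanreal (\<lambda>a. a i)"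
  by (rule continuous_map_product_projection) simp

lemma continuous_map_weighted_sum:
  "continuous_map (powertop_real UNIV) euclideanreal (\<lambda>a. \<Sum>i<k. \<bar>a i - b i\<bar> powr p * w i)"
proof (intro continuous_map_sum continuous_map_real_mult)
  fix i
  have "continuous_on UNIV (\<lambda>t::real. \<bar>t - b i\<bar> powr p)"
    using p by (intro continuous_on_powr' continuous_intros) auto
  then have "continuous_map euclideanreal euclideanreal (\<lambda>t. \<bar>t - b i\<bar> powr p)" by simp
  from continuous_map_compose[OF continuous_map_coordinate[of i] this]
  show "continuous_map (powertop_real UNIV) euclideanreal (\<lambda>a. \<bar>a i - b i\<bar> powr p)"
    by (simp add: o_def)
qed auto

text \<open>By \<open>sobolev_norm_comb\<close> the Sobolev distance of two combinations is a root
  of a finite weighted sum of \<open>p\<close>-th powers of coefficient differences, which is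
  continuous in the product topology.\<close>

lemma continuous_map_comb: "continuous_map (powertop_real UNIV) (sobolev_topology p \<Omega>) comb"
  unfolding continuous_map
proof (intro conjI allI impI)
  show "comb ` topspace (powertop_real UNIV) \<subseteq> topspace (sobolev_topology p \<Omega>)"
    using comb_in_sobolev_space by auto
  fix V assume "openin (sobolev_topology p \<Omega>) V"
  then have V: "\<And>v. v \<in> V \<Longrightarrow> \<exists>\<epsilon>>0. \<forall>w\<in>sobolev_space p \<Omega>. sobolev_norm p \<Omega> (w - v) < \<epsilon> \<longrightarrow> w \<in> V"
    unfolding openin_sobolev_topology by blast
  show "openin (powertop_real UNIV) {a \<in> topspace (powertop_real UNIV). comb a \<in> V}"
  proof (subst openin_subopen, intro ballI)
    fix b assume "b \<in> {a \<in> topspace (powertop_real UNIV). comb a \<in> V}"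
    then obtain \<epsilon> where \<epsilon>: "\<epsilon> > 0"
      "\<And>w. w \<in> sobolev_space p \<Omega> \<Longrightarrow> sobolev_norm p \<Omega> (w - comb b) < \<epsilon> \<Longrightarrow> w \<in> V"
      using V[of "comb b"] by blast
    define S where "S a = (\<Sum>i<k. \<bar>a i - b i\<bar> powr p * (energy i + mass i))" for a
    define T where "T = {a \<in> topspace (powertop_real UNIV). S a \<in> {..<\<epsilon> powr p}}"
    have "openin (powertop_real UNIV) T"
      unfolding T_def S_def
      by (rule openin_continuous_map_preimage[OF continuous_map_weighted_sum]) simp
    moreover have "b \<in> T" using \<epsilon>(1) p by (simp add: T_def S_def)
    moreover have "comb a \<in> V" if "a \<in> T" for a
    proof (rule \<epsilon>(2)[OF comb_in_sobolev_space])
      have "S a \<ge> 0"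
        unfolding S_def using energy_nonneg mass_pos' by (intro sum_nonneg mult_nonneg_nonneg) (auto simp: less_imp_le add_nonneg_pos)
      moreover have "S a < \<epsilon> powr p" using that by (simp add: T_def)
      ultimately have "S a powr (1 / p) < (\<epsilon> powr p) powr (1 / p)"
        using p by (intro powr_less_mono2) auto
      then show "sobolev_norm p \<Omega> (comb a - comb b) < \<epsilon>"
        using \<epsilon>(1) p by (simp add: comb_diff sobolev_norm_comb S_def powr_powr)
    qed
    ultimately show "\<exists>T. openin (powertop_real UNIV) T \<and> b \<in> T \<and>
        T \<subseteq> {a \<in> topspace (powertop_real UNIV). comb a \<in> V}"
      by auto
  qed
qed

lemma compactin_unit_coefficients:
  "compactin (powertop_real UNIV) {a. (\<forall>i\<ge>k. a i = 0) \<and> (\<Sum>i<k. \<bar>a i\<bar> powr p * mass i) = 1}"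
    (is "compactin _ ?A")
proof -
  \<comment> \<open>Each summand is at most the total 1, which confines \<open>a i\<close> to this
    interval; the coordinates from \<open>k\<close> on are pinned to 0.\<close>
  define B where "B i = (if i < k then {- ((1 / mass i) powr (1 / p))..(1 / mass i) powr (1 / p)} else {0})" for i
  have "compactin (powertop_real UNIV) (PiE UNIV B)"
    unfolding compactin_PiE by (auto simp: B_def)
  moreover have "?A \<subseteq> PiE UNIV B"
  proof
    fix a assume a: "a \<in> ?A"
    have "a i \<in> B i" for i
    proof (cases "i < k")
      case True
      have "\<bar>a i\<bar> powr p * mass i \<le> (\<Sum>i<k. \<bar>a i\<bar> powr p * mass i)"
        by (rule member_le_sum) (use True mass_pos' in \<open>auto simp: less_imp_le\<close>)
      then have "\<bar>a i\<bar> powr p \<le> 1 / mass i"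
        using a mass_pos'[OF True] by (simp add: field_simps)
      then have "(\<bar>a i\<bar> powr p) powr (1 / p) \<le> (1 / mass i) powr (1 / p)"
        using p by (intro powr_mono2) auto
      then have "\<bar>a i\<bar> \<le> (1 / mass i) powr (1 / p)"
        using p by (simp add: powr_powr)
      then show ?thesis using True by (auto simp: B_def abs_le_iff)
    next
      case False
      then show ?thesis using a by (simp add: B_def)
    qed
    then show "a \<in> PiE UNIV B" by auto
  qed
  moreover have "closedin (powertop_real UNIV) ?A"
  proof -
    have "closedin (powertop_real UNIV) {a \<in> topspace (powertop_real UNIV). a i \<in> {0}}" for i
      by (rule closedin_continuous_map_preimage[OF continuous_map_coordinate]) simp
    then have "closedin (powertop_real UNIV) (\<Inter>i\<in>{k..}. {a \<in> topspace (powertop_real UNIV). a i \<in> {0}})"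
      by (intro closedin_INT) auto
    moreover have "closedin (powertop_real UNIV)
        {a \<in> topspace (powertop_real UNIV). (\<Sum>i<k. \<bar>a i - 0\<bar> powr p * mass i) \<in> {1}}"
      by (rule closedin_continuous_map_preimage[OF continuous_map_weighted_sum]) simp
    ultimately have "closedin (powertop_real UNIV)
       ((\<Inter>i\<in>{k..}. {a \<in> topspace (powertop_real UNIV). a i \<in> {0}}) \<inter>
        {a \<in> topspace (powertop_real UNIV). (\<Sum>i<k. \<bar>a i - 0\<bar> powr p * mass i) \<in> {1}})"
      by (rule closedin_Int)
    also have "\<dots> = ?A" by auto
    finally show ?thesis .
  qed
  ultimately show ?thesis by (rule closed_compactin)
qed

text \<open>Composing an odd map on the set of combinations with \<open>comb\<close> gives an odd
  map between punctured Euclidean spaces, to which Borsuk-Ulam applies.\<close>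

lemma genus_comb: "genus (sobolev_topology p \<Omega>) (comb ` coeffs) \<ge> enat k"
  unfolding genus_def
proof (rule Inf_greatest)
  fix m assume "m \<in> {enat l |l. \<exists>f. continuous_map (subtopology (sobolev_topology p \<Omega>) (comb ` coeffs))
      (punctured_space l) f \<and> (\<forall>u\<in>comb ` coeffs. f (- u) = - f u)}"
  then obtain l f where l: "m = enat l"
    and f: "continuous_map (subtopology (sobolev_topology p \<Omega>) (comb ` coeffs)) (punctured_space l) f"
      "\<And>u. u \<in> comb ` coeffs \<Longrightarrow> f (- u) = - f u" by blast
  have "continuous_map (punctured_space k) (sobolev_topology p \<Omega>) comb"
    using continuous_map_comb by (simp add: Euclidean_space_def continuous_map_from_subtopology)
  then have "continuous_map (punctured_space k) (subtopology (sobolev_topology p \<Omega>) (comb ` coeffs)) comb"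
    by (auto simp: continuous_map_in_subtopology)
  then have "continuous_map (punctured_space k) (punctured_space l) (f \<circ> comb)"
    using f(1) by (rule continuous_map_compose)
  then have "k \<le> l"
    by (rule Borsuk_Ulam_punctured_space) (use f(2) in \<open>simp add: comb_uminus del: topspace_subtopology\<close>)
  then show "enat k \<le> m" by (simp add: l)
qed

text \<open>A nonzero coefficient makes the \<open>L^p\<close> mass positive, so no combination is
  null. The unit sphere of \<open>L^p\<close> corresponds to a compact set of coefficients, and its
  image under the continuous map \<open>comb\<close> is compact.\<close>

lemma comb_admissible: "comb ` coeffs \<in> admissible_sets k p \<Omega>"
proof -
  have pos: "(LINT x|lebesgue_on \<Omega>. \<bar>comb a x\<bar> powr p) > 0" if "a \<in> coeffs" for a
    using coeffs_nonzero[OF that] comb_norm_pos unfolding comb_integral by metis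
  have "\<not> (AE x in lebesgue_on \<Omega>. comb a x = 0)" if a: "a \<in> coeffs" for a
  proof
    assume "AE x in lebesgue_on \<Omega>. comb a x = 0"
    then have "AE x in lebesgue_on \<Omega>. \<bar>comb a x\<bar> powr p = 0"
      by eventually_elim simp
    then have "(LINT x|lebesgue_on \<Omega>. \<bar>comb a x\<bar> powr p) = 0"
      by (rule integral_eq_zero_AE)
    with pos[OF a] show False by simp
  qed
  moreover have "compactin (sobolev_topology p \<Omega>) (comb ` coeffs \<inter> {u. lp_norm p \<Omega> u = 1})"
  proof -
    have root: "x powr (1 / p) = 1 \<longleftrightarrow> x = 1" if "x > 0" for x :: real
    proof
      assume "x powr (1 / p) = 1"
      moreover have "(x powr (1 / p)) powr p = x" using that p by (simp add: powr_powr)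
      ultimately show "x = 1" by simp
    qed simp
    have "lp_norm p \<Omega> (comb a) = 1 \<longleftrightarrow> (\<Sum>i<k. \<bar>a i\<bar> powr p * mass i) = 1" if "a \<in> coeffs" for a
      using root[OF pos[OF that]] unfolding lp_norm_def comb_integral .
    \<comment> \<open>The zero sequence is excluded because its sum is 0.\<close>
    moreover have "{a. (\<forall>i\<ge>k. a i = 0) \<and> (\<Sum>i<k. \<bar>a i\<bar> powr p * mass i) = 1} \<subseteq> coeffs"
      unfolding subset_iff coeffs_iff using p by auto
    ultimately have "comb ` coeffs \<inter> {u. lp_norm p \<Omega> u = 1} =
        comb ` {a. (\<forall>i\<ge>k. a i = 0) \<and> (\<Sum>i<k. \<bar>a i\<bar> powr p * mass i) = 1}"
      using coeffs_iff by blast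
    then show ?thesis
      using image_compactin[OF compactin_unit_coefficients continuous_map_comb] by simp
  qed
  moreover have "comb ` coeffs = uminus ` comb ` coeffs"
  proof -
    have "- a \<in> coeffs" if "a \<in> coeffs" for a
      using that unfolding coeffs_iff by (auto simp: fun_eq_iff)
    moreover have "uminus (comb (- a)) = comb a" for a
      by (simp add: comb_uminus fun_eq_iff)
    ultimately show ?thesis
      unfolding image_image comb_uminus[symmetric]
      by (auto simp del: topspace_subtopology) (metis comb_uminus imageI)+
  qed
  ultimately show ?thesis
    using comb_in_sobolev_space genus_comb unfolding admissible_sets_def by blast
qed

text \<open>Numerator and denominator of the Rayleigh quotient are sums with the same weights
  \<open>\<bar>a i\<bar> powr p\<close>, so the termwise bound carries over to the quotient.\<close>

theorem neumann_eigenvalue_le: "neumann_eigenvalue k p \<Omega> \<le> ereal \<Lambda>"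
  unfolding neumann_eigenvalue_def
proof (rule INF_lower2[OF comb_admissible], rule SUP_least)
  fix v assume "v \<in> comb ` coeffs"
  then obtain a where a: "a \<in> coeffs" "v = comb a" by blast
  obtain j where j: "j < k" "a j \<noteq> 0" using coeffs_nonzero[OF a(1)] .
  have "(\<Sum>i<k. \<bar>a i\<bar> powr p * energy i) \<le> (\<Sum>i<k. \<bar>a i\<bar> powr p * (\<Lambda> * mass i))"
    by (intro sum_mono mult_left_mono) (use energy_le in \<open>auto simp: energy_def mass_def\<close>)
  also have "\<dots> = \<Lambda> * (\<Sum>i<k. \<bar>a i\<bar> powr p * mass i)"
    by (simp add: sum_distrib_left mult_ac)
  finally show "ereal (rayleigh_quotient p \<Omega> v) \<le> ereal \<Lambda>"
    unfolding a(2) rayleigh_quotient_def weak_gradient_comb_integral comb_integral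
    using comb_norm_pos[of j a, OF j] by (simp add: divide_le_eq)
qed

end

subsection \<open>The eigenvalue bound\<close>

lemma lebesgue_on_integral_indicator:
  assumes "\<Omega> \<in> sets borel" "A \<in> sets borel"
  shows "(LINT x|lebesgue_on \<Omega>. a * indicator A x) = a * measure lborel (\<Omega> \<inter> A)"
proof -
  have "(LINT x|lebesgue_on \<Omega>. a * indicator A x) = a * measure (lebesgue_on \<Omega>) (A \<inter> space (lebesgue_on \<Omega>))"
    by simp
  also have "\<dots> = a * measure lebesgue (\<Omega> \<inter> A)"
    using assms by (subst measure_restrict_space) (auto simp: Int_commute sets_completionI_sets)
  also have "\<dots> = a * measure lborel (\<Omega> \<inter> A)"
    using assms by (simp add: measure_completion)
  finally show ?thesis .
qed

text \<open>The factors come from the gradient bound \<open>4 / r\<close>, the doubling constant,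
  the lower bound \<open>9 / 16\<close> of the bumps on the half balls, and the value of
  \<open>r\<close> in terms of \<open>k\<close> and the volume.\<close>

lemma neumann_eigenvalue_le_powr:
  fixes \<Omega> :: "'a::euclidean_space set"
  defines "\<omega> \<equiv> measure lborel (ball (0 :: 'a) 1)"
  assumes p: "p > 1" and "open \<Omega>" "bounded \<Omega>" "\<Omega> \<noteq> {}" and "k \<ge> 1"
  shows "neumann_eigenvalue k p \<Omega> \<le>
    ereal (4 powr p * 2 ^ (DIM('a) + 2) * (16 / 9) powr p * (2 * 3 ^ DIM('a) * \<omega>) powr (p / DIM('a)) *
      (k / measure lebesgue \<Omega>) powr (p / DIM('a)))"
proof -
  let ?D = "DIM('a)"
  define V where "V = measure lborel \<Omega>"
  have \<Omega>: "\<Omega> \<in> sets borel" using \<open>open \<Omega>\<close> by simp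
  have fin: "emeasure lborel \<Omega> < \<infinity>" by (rule emeasure_bounded_finite[OF \<open>bounded \<Omega>\<close>])
  have V_leb: "measure lebesgue \<Omega> = V" unfolding V_def using \<Omega> by (simp add: measure_completion)
  have "\<omega> > 0" unfolding \<omega>_def using content_ball_pos[of 1 "0::'a"] by simp
  have "V > 0"
  proof -
    obtain x e where "e > 0" "ball x e \<subseteq> \<Omega>"
      using \<open>open \<Omega>\<close> \<open>\<Omega> \<noteq> {}\<close> by (meson ex_in_conv open_contains_ball)
    then have "0 < measure lborel (ball x e)" "measure lborel (ball x e) \<le> V"
      using content_ball_pos[of e x] \<Omega> fin unfolding V_def
      by (auto intro!: measure_mono_fmeasurable simp: fmeasurable_def)
    then show ?thesis by linarith
  qed
  \<comment> \<open>the radius \<open>r\<close> for which \<open>k\<close> balls of radius \<open>3 * r\<close> fill half of the volume of \<open>\<Omega>\<close>\<close>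
  define q where "q = 2 * 3 ^ ?D * \<omega> * (k / V)"
  have "q > 0" using \<open>\<omega> > 0\<close> \<open>V > 0\<close> \<open>k \<ge> 1\<close> by (simp add: q_def)
  define r where "r = (1 / q) powr (1 / ?D)"
  have "r > 0" using \<open>q > 0\<close> by (simp add: r_def)
  have rD: "r ^ ?D = 1 / q"
    using \<open>q > 0\<close> by (simp add: r_def powr_powr flip: powr_realpow)
  have r_powr: "(1 / r) powr p = q powr (p / ?D)"
    using \<open>q > 0\<close> by (simp add: r_def powr_powr powr_divide)
  \<comment> \<open>Equality holds here, by the choice of \<open>q\<close>.\<close>
  have "2 * real k * measure lborel (ball (0 :: 'a) (3 * r)) \<le> V"
    using measure_lborel_ball[of "3 * r" "0 :: 'a"] \<open>r > 0\<close> \<open>\<omega> > 0\<close> \<open>V > 0\<close> \<open>k \<ge> 1\<close>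
    by (simp add: power_mult_distrib rD flip: \<omega>_def) (simp add: q_def)
  then obtain c :: "nat \<Rightarrow> 'a" where
    pos: "\<And>i. i < k \<Longrightarrow> measure lborel (\<Omega> \<inter> ball (c i) (r / 2)) > 0" and
    dbl: "\<And>i. i < k \<Longrightarrow> measure lborel (\<Omega> \<inter> ball (c i) r) \<le>
       2 ^ (?D + 2) * measure lborel (\<Omega> \<inter> ball (c i) (r / 2))" and
    sep: "\<And>i j. i < k \<Longrightarrow> j < k \<Longrightarrow> i \<noteq> j \<Longrightarrow> dist (c i) (c j) \<ge> 2 * r"
    using separated_doubling_centers[OF \<Omega> fin _ \<open>r > 0\<close>, of k] \<open>V > 0\<close> unfolding V_def by metis
  let ?u = "\<lambda>i. ball_bump (c i) r" and ?G = "\<lambda>i. ball_bump_gradient (c i) r"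
  let ?M = "lebesgue_on \<Omega>"
  define \<Lambda> where "\<Lambda> = (4 / r) powr p * 2 ^ (?D + 2) * (16 / 9) powr p"
  \<comment> \<open>Finite measure makes the bounded powers of bumps and gradients
    integrable.\<close>
  interpret finite_measure ?M
    by (rule finite_measure_lebesgue_on) (simp add: \<open>bounded \<Omega>\<close> \<open>open \<Omega>\<close> lmeasurable_open)
  have u_cont: "continuous_on UNIV (?u i)" for i
    using ball_bump_has_derivative by (meson continuous_at_imp_continuous_on has_derivative_continuous)
  have [measurable]: "?u i \<in> borel_measurable ?M" "?G i \<in> borel_measurable ?M" for i
    using \<open>open \<Omega>\<close> by (auto intro!: continuous_imp_measurable_on_sets_lebesgue
        intro: continuous_on_subset[OF u_cont] continuous_on_subset[OF continuous_ball_bump_gradient])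
  have u_le: "\<bar>?u i x\<bar> powr p \<le> 1" for i x
    using ball_bump_bounds(1,2)[OF \<open>r > 0\<close>, of "c i" x] p by (simp add: powr_le1)
  have G_le: "norm (?G i x) powr p \<le> (4 / r) powr p" for i x
    using ball_bump_bounds(3)[OF \<open>r > 0\<close>, of "c i" x] p by (intro powr_mono2) auto
  have u_int: "integrable ?M (\<lambda>x. \<bar>?u i x\<bar> powr p)" for i
    by (rule integrable_const_bound[where B = 1]) (use u_le in auto)
  have G_int: "integrable ?M (\<lambda>x. norm (?G i x) powr p)" for i
    by (rule integrable_const_bound[where B = "(4 / r) powr p"]) (use G_le in auto)
  have ind_int: "integrable ?M (\<lambda>x. a * indicator (ball z \<rho>) x)" for a :: real and z \<rho>
  proof (rule integrable_const_bound[where B = "\<bar>a\<bar>"])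
    show "(\<lambda>x. a * indicator (ball z \<rho>) x) \<in> borel_measurable ?M"
      by (intro measurable_restrict_space1 borel_measurable_times borel_measurable_indicator) auto
  qed (auto simp: indicator_def)
  have mass: "(9 / 16) powr p * measure lborel (\<Omega> \<inter> ball (c i) (r / 2)) \<le> (LINT x|?M. \<bar>?u i x\<bar> powr p)" for i
  proof -
    have "(LINT x|?M. (9 / 16) powr p * indicator (ball (c i) (r / 2)) x) \<le> (LINT x|?M. \<bar>?u i x\<bar> powr p)"
    proof (rule integral_mono[OF ind_int u_int])
      fix x
      show "(9 / 16) powr p * indicator (ball (c i) (r / 2)) x \<le> \<bar>?u i x\<bar> powr p"
        using ball_bump_bounds(4)[OF \<open>r > 0\<close>, of x "c i"] p
        by (cases "x \<in> ball (c i) (r / 2)") (auto intro!: powr_mono2)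
    qed
    then show ?thesis
      by (simp only: lebesgue_on_integral_indicator[OF \<Omega> borel_open[OF open_ball]])
  qed
  have energy: "(LINT x|?M. norm (?G i x) powr p) \<le> (4 / r) powr p * measure lborel (\<Omega> \<inter> ball (c i) r)" for i
  proof -
    have "(LINT x|?M. norm (?G i x) powr p) \<le> (LINT x|?M. (4 / r) powr p * indicator (ball (c i) r) x)"
    proof (rule integral_mono[OF G_int ind_int])
      fix x
      show "norm (?G i x) powr p \<le> (4 / r) powr p * indicator (ball (c i) r) x"
        using G_le[of i x] ball_bump_outside(2)[OF \<open>r > 0\<close>, of x "c i"]
        by (cases "x \<in> ball (c i) r") auto
    qed
    then show ?thesis
      by (simp only: lebesgue_on_integral_indicator[OF \<Omega> borel_open[OF open_ball]])
  qed
  interpret disjoint_family_C1 \<Omega> p k \<Lambda> ?u ?G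
  proof
    show "(?u i x = 0 \<and> ?G i x = 0) \<or> (?u j x = 0 \<and> ?G j x = 0)" if "i < k" "j < k" "i \<noteq> j" for i j x
    proof -
      have "x \<notin> ball (c i) r \<or> x \<notin> ball (c j) r"
        using sep[OF that] dist_triangle2[of "c i" "c j" x] by auto
      then show ?thesis using ball_bump_outside[OF \<open>r > 0\<close>] by blast
    qed
    fix i assume i: "i < k"
    have "0 < (9 / 16) powr p * measure lborel (\<Omega> \<inter> ball (c i) (r / 2))"
      using pos[OF i] by simp
    then show "0 < (LINT x|?M. \<bar>?u i x\<bar> powr p)" using mass[of i] by linarith
    have E: "(LINT x|?M. norm (?G i x) powr p) \<le>
        (4 / r) powr p * (2 ^ (?D + 2) * measure lborel (\<Omega> \<inter> ball (c i) (r / 2)))"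
      using energy[of i] mult_left_mono[OF dbl[OF i], of "(4 / r) powr p"] by simp
    have m: "measure lborel (\<Omega> \<inter> ball (c i) (r / 2)) \<le> (16 / 9) powr p * (LINT x|?M. \<bar>?u i x\<bar> powr p)"
    proof -
      have "(16 / 9 :: real) powr p * (9 / 16) powr p = 1" by (simp flip: powr_mult)
      then show ?thesis
        using mult_left_mono[OF mass[of i], of "(16 / 9) powr p"] by (simp flip: mult.assoc)
    qed
    have "(4 / r) powr p * (2 ^ (?D + 2) * measure lborel (\<Omega> \<inter> ball (c i) (r / 2))) \<le>
        (4 / r) powr p * (2 ^ (?D + 2) * ((16 / 9) powr p * (LINT x|?M. \<bar>?u i x\<bar> powr p)))"
      by (intro mult_left_mono m) auto
    with E show "(LINT x|?M. norm (?G i x) powr p) \<le> \<Lambda> * (LINT x|?M. \<bar>?u i x\<bar> powr p)"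
      unfolding \<Lambda>_def by (simp only: mult.assoc)
  qed (use \<open>open \<Omega>\<close> p ball_bump_has_derivative continuous_ball_bump_gradient u_int G_int in auto)
  have "\<Lambda> = 4 powr p * (1 / r) powr p * 2 ^ (?D + 2) * (16 / 9) powr p"
    unfolding \<Lambda>_def by (simp add: powr_divide)
  also have "(1 / r) powr p = (2 * 3 ^ ?D * \<omega>) powr (p / ?D) * (k / V) powr (p / ?D)"
    unfolding r_powr q_def by (rule powr_mult)
  finally show ?thesis
    using neumann_eigenvalue_le by (simp add: V_leb mult_ac)
qed

theorem corollary1p8:
  fixes p :: real
  assumes "CARD('n::finite) \<ge> 2" and "p > 1"
  shows "\<exists>B>0. \<forall>(\<Omega> :: (real ^ 'n) set) (k :: nat).
           bounded_domain \<Omega> \<longrightarrow> smooth_boundary \<Omega> \<longrightarrow> k \<ge> 1 \<longrightarrow>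
           neumann_eigenvalue k p \<Omega>
             \<le> ereal (B * (real k / measure lebesgue \<Omega>) powr (p / real CARD('n)))"
proof (intro exI conjI allI impI)
  \<comment> \<open>The constant of \<open>neumann_eigenvalue_le_powr\<close> in dimension
    \<open>CARD('n)\<close>, fixed before \<open>\<Omega>\<close> and \<open>k\<close>; it contains
    only \<open>p\<close>, the dimension and the volume of the unit ball.\<close>
  let ?B = "4 powr p * 2 ^ (CARD('n) + 2) * (16 / 9) powr p *
      (2 * 3 ^ CARD('n) * measure lborel (ball (0 :: real ^ 'n) 1)) powr (p / CARD('n))"
  show "?B > 0"
    using content_ball_pos[of 1 "0 :: real ^ 'n"] by (intro mult_pos_pos) auto
  fix \<Omega> :: "(real ^ 'n) set" and k :: nat
  assume "bounded_domain \<Omega>" "k \<ge> 1"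
  then show "neumann_eigenvalue k p \<Omega>
      \<le> ereal (?B * (real k / measure lebesgue \<Omega>) powr (p / real CARD('n)))"
    using neumann_eigenvalue_le_powr[OF \<open>p > 1\<close>, of \<Omega> k] by (simp add: bounded_domain_def)
qed

end
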